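(* Let $n$ be an even positive integer, let $G=\mathrm{SO}(n+1)$, and let $a=\mathrm{diag}(1,1,\dots,1,-1)\in\mathrm{O}(n)$ be identified with $a=\mathrm{diag}(1,1,\dots,1,-1,-1)\in\mathrm{SO}(n+1)$. Let $(V_\tau,\tau)$ be a unitary irreducible (finite dimensional, complex) representation of $G$ and $(V_\pi,\pi)$ a unitary irreducible representation of $\mathrm{SO}(n)$. Suppose that $\pi$ is a sub-representation of $\tau_{|\mathrm{SO}(n)}$, with $V_\pi\subset V_\tau$, and that $\pi$ is not equivalent to $\pi_\phi$, where $\pi_\phi(k)=\pi(aka)$ for $k\in\mathrm{SO}(n)$, acting on $V_{\pi_\phi}=V_\pi$. Then $\tau(a)V_\pi\sim V_{\pi_\phi}$ as $\mathrm{SO}(n)$-modules, and $V_\pi\oplus\tau(a)V_\pi$ is an irreducible $\mathrm{O}(n)$-submodule of $V_\tau$ equivalent to the irreducible representation $\gamma$ of $\mathrm{O}(n)$ on $V_\pi\times V_{\pi_\phi}$ defined by $$\gamma(k)(v,w)=(\pi(k)v,\pi_\phi(k)w),\qquad \gamma(ka)(v,w)=(\pi(k)w,\pi_\phi(k)v)$$ for $k\in\mathrm{SO}(n)$, $v\in V_\pi$, $w\in V_{\pi_\phi}$. Moreover, under the identification $V_\pi\times V_{\pi_\phi}\simeq V_\pi\oplus\tau(a)V_\pi$, $(v,w)\mapsto v+\tau(a)w$, $$\Phi^{\tau,\gamma}(g)=\begin{pmatrix}\Phi^{\tau,\pi}(g)&\Phi^{\tau,\pi}(ga)\\ \Phi^{\tau,\pi_\phi}(ga)&\Phi^{\tau,\pi_\phi}(g)\end{pmatrix}$$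 for all $g\in G$.
   Context: Embeddings: $\mathrm{O}(n)$ is regarded as a subgroup of $G=\mathrm{SO}(n+1)$ via $k\mapsto \begin{pmatrix} k&0\\0&\det k\end{pmatrix}$; restricting gives $\mathrm{SO}(n)\subset G$. For $n$ even, $\mathrm{O}(n)=\mathrm{SO}(n)\rtimes\{1,a\}$. Spherical functions: let $K$ be a compact subgroup of $G$ with Haar measure $dk$ normalized by $\int_K dk=1$, and let $\delta$ be an irreducible finite dimensional complex representation of $K$ with degree $d(\delta)$, character $\xi_\delta$, and $\chi_\delta=d(\delta)\xi_\delta$. Let $P_\delta=\int_K\chi_\delta(k^{-1})\tau(k)\,dk$ be the projection of $V_\tau$ onto its $\delta$-isotypic subspace $V_\tau(\delta)=P_\delta V_\tau$. The spherical function of type $\delta$ associated with $\tau$ is $\Phi^{\tau,\delta}:G\to\mathrm{End}(V_\tau(\delta))$, $\Phi^{\tau,\delta}(g)v=P_\delta\tau(g)v$ for $v\in V_\tau(\delta)$. Here $\Phi^{\tau,\pi}$ and $\Phi^{\tau,\pi_\phi}$ are taken with $K=\mathrm{SO}(n)$ and $\Phi^{\tau,\gamma}$ with $K=\mathrm{O}(n)$. Each irreducible representation of $\mathrm{SO}(n)$ occurs in $\tau_{|\mathrm{SO}(n)}$ with multiplicity at most one, so $V_\tau(\pi)=V_\pi$ and $V_\tau(\pi_\phi)=\tau(a)V_\pi$. In the block matrix, all four blocks are read as endomorphisms of the vector space $V_\pi=V_{\pi_\phi}$: $\Phi^{\tau,\pi}(\cdot)$ acts on $V_\pi\subset V_\tau$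 directly, and $\Phi^{\tau,\pi_\phi}(\cdot)\in\mathrm{End}(\tau(a)V_\pi)$ is transported to $V_{\pi_\phi}=V_\pi$ through the isomorphism $V_{\pi_\phi}\to\tau(a)V_\pi$, $w\mapsto\tau(a)w$. *)

theory Defs
  imports "HOL-Analysis.Analysis"
begin

section \<open>The groups and the embedding\<close>

definition Orth :: "(real^'n^'n) set" where
  "Orth = {A. orthogonal_matrix A}"

definition SO :: "(real^'n^'n) set" where
  "SO = {A. rotation_matrix A}"

text \<open>
  The (n+1)-dimensional space is indexed by \<^typ>\<open>'n option\<close>, with \<^term>\<open>None\<close> as the additional
  (last) coordinate; \<open>embed_SO k\<close> is the block matrix \<open>diag (k, det k)\<close>.
\<close>

definition embed_SO :: "real^'n^'n \<Rightarrow> real^('n option)^('n option)" where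
  "embed_SO k = (\<chi> i j. case (i, j) of
      (Some p, Some q) \<Rightarrow> k $ p $ q
    | (None, None) \<Rightarrow> det k
    | _ \<Rightarrow> 0)"

text \<open>
  A finite index type carries no order, so the coordinate that plays the part of the n-th one
  is a parameter \<open>l\<close>: this is diag(1,...,1,-1) for any enumeration of the index type that ends in \<open>l\<close>.
\<close>

definition reflection :: "'n \<Rightarrow> real^'n^'n" where
  "reflection l = (\<chi> i j. if i = j then (if i = l then - 1 else 1) else 0)"

section \<open>Finite dimensional complex representations\<close>

text \<open>
  A representation consists of a set \<open>K\<close> of matrices (a group under \<open>**\<close>), a complex vector space
  \<open>V\<close>, given as a complex subspace of a type with complex scalar multiplication \<open>s\<close>, and an action \<open>\<rho>\<close>
  that matters only on \<open>K\<close> and \<open>V\<close>. The class \<^class>\<open>euclidean_space\<close> makes \<open>V\<close> finite dimensional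
  and supplies its topology. The parameter \<open>s\<close> is needed because pairs of complex vectors have
  no predefined complex scalar multiplication.
\<close>

definition matrix_group_rep ::
  "(real^'m^'m) set \<Rightarrow> (complex \<Rightarrow> 'v \<Rightarrow> 'v) \<Rightarrow> 'v::euclidean_space set \<Rightarrow> (real^'m^'m \<Rightarrow> 'v \<Rightarrow> 'v) \<Rightarrow> bool"
  where
  "matrix_group_rep K s V \<rho> \<longleftrightarrow>
     module.subspace s V \<and>
     (\<forall>k\<in>K. \<forall>v\<in>V. \<rho> k v \<in> V) \<and>
     (\<forall>k\<in>K. \<forall>v\<in>V. \<forall>w\<in>V. \<rho> k (v + w) = \<rho> k v + \<rho> k w) \<and>
     (\<forall>k\<in>K. \<forall>c. \<forall>v\<in>V. \<rho> k (s c v) = s c (\<rho> k v)) \<and>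
     (\<forall>v\<in>V. \<rho> (mat 1) v = v) \<and>
     (\<forall>k\<in>K. \<forall>l\<in>K. \<forall>v\<in>V. \<rho> (k ** l) v = \<rho> k (\<rho> l v)) \<and>
     (\<forall>v\<in>V. continuous_on K (\<lambda>k. \<rho> k v))"

definition irreducible_representation ::
  "(real^'m^'m) set \<Rightarrow> (complex \<Rightarrow> 'v \<Rightarrow> 'v) \<Rightarrow> 'v::euclidean_space set \<Rightarrow> (real^'m^'m \<Rightarrow> 'v \<Rightarrow> 'v) \<Rightarrow> bool"
  where
  "irreducible_representation K s V \<rho> \<longleftrightarrow>
     matrix_group_rep K s V \<rho> \<and> V \<noteq> {0} \<and>
     (\<forall>W. module.subspace s W \<and> W \<subseteq> V \<and> (\<forall>k\<in>K. \<forall>w\<in>W. \<rho> k w \<in> W) \<longrightarrow> W = {0} \<or> W = V)"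

definition equivalent_representations ::
  "(real^'m^'m) set \<Rightarrow>
   (complex \<Rightarrow> 'v \<Rightarrow> 'v) \<Rightarrow> 'v::euclidean_space set \<Rightarrow> (real^'m^'m \<Rightarrow> 'v \<Rightarrow> 'v) \<Rightarrow>
   (complex \<Rightarrow> 'w \<Rightarrow> 'w) \<Rightarrow> 'w::euclidean_space set \<Rightarrow> (real^'m^'m \<Rightarrow> 'w \<Rightarrow> 'w) \<Rightarrow> bool"
  where
  "equivalent_representations K s V \<rho> s' V' \<rho>' \<longleftrightarrow>
     (\<exists>T. bij_betw T V V' \<and>
          (\<forall>v\<in>V. \<forall>w\<in>V. T (v + w) = T v + T w) \<and>
          (\<forall>c. \<forall>v\<in>V. T (s c v) = s' c (T v)) \<and>
          (\<forall>k\<in>K. \<forall>v\<in>V. T (\<rho> k v) = \<rho>' k (T v)))"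

definition herm :: "complex^'d \<Rightarrow> complex^'d \<Rightarrow> complex" where
  "herm v w = (\<Sum>i\<in>UNIV. v $ i * cnj (w $ i))"

definition unitary_on ::
  "(real^'m^'m) set \<Rightarrow> (complex^'d) set \<Rightarrow> (real^'m^'m \<Rightarrow> complex^'d \<Rightarrow> complex^'d) \<Rightarrow> bool" where
  "unitary_on K V \<rho> \<longleftrightarrow> (\<forall>k\<in>K. \<forall>v\<in>V. \<forall>w\<in>V. herm (\<rho> k v) (\<rho> k w) = herm v w)"

abbreviation scale_pair :: "complex \<Rightarrow> (complex^'d) \<times> (complex^'d) \<Rightarrow> (complex^'d) \<times> (complex^'d)" where
  "scale_pair \<equiv> module_prod.scale (*s) (*s)"

section \<open>Characters, Haar measure and spherical functions\<close>

text \<open>Trace of a linear endomorphism of the subspace \<open>V\<close>; independent of the basis chosen.\<close>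

definition trace_on :: "(complex \<Rightarrow> 'v \<Rightarrow> 'v) \<Rightarrow> 'v::euclidean_space set \<Rightarrow> ('v \<Rightarrow> 'v) \<Rightarrow> complex" where
  "trace_on s V T =
     (let B = (SOME B. \<not> module.dependent s B \<and> module.span s B = V)
      in \<Sum>b\<in>B. module.representation s B (T b) b)"

definition chi ::
  "(complex \<Rightarrow> 'v \<Rightarrow> 'v) \<Rightarrow> 'v::euclidean_space set \<Rightarrow> (real^'m^'m \<Rightarrow> 'v \<Rightarrow> 'v) \<Rightarrow> real^'m^'m \<Rightarrow> complex"
  where
  "chi s V \<delta> k = of_nat (vector_space.dim s V) * trace_on s V (\<delta> k)"

definition normalized_haar :: "(real^'m^'m) set \<Rightarrow> (real^'m^'m) measure \<Rightarrow> bool" where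
  "normalized_haar K \<mu> \<longleftrightarrow>
     sets \<mu> = sets (restrict_space borel K) \<and> emeasure \<mu> K = 1 \<and>
     (\<forall>g\<in>K. distr \<mu> \<mu> (\<lambda>k. g ** k) = \<mu>)"

text \<open>
  In the following, \<open>\<tau>\<close> is a representation of SO(n+1) on all of \<^typ>\<open>complex^'d\<close>, \<open>\<mu>\<close> is the Haar
  measure of a compact subgroup of O(n) which is regarded as a subgroup of SO(n+1) by
  \<^const>\<open>embed_SO\<close>, and \<open>\<delta>\<close> is a representation of that subgroup on \<open>V\<close>.
\<close>

definition isotypic_projection ::
  "(real^'n^'n) measure \<Rightarrow>
   (complex \<Rightarrow> 'v \<Rightarrow> 'v) \<Rightarrow> 'v::euclidean_space set \<Rightarrow> (real^'n^'n \<Rightarrow> 'v \<Rightarrow> 'v) \<Rightarrow>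
   (real^('n option)^('n option) \<Rightarrow> complex^'d \<Rightarrow> complex^'d) \<Rightarrow> complex^'d \<Rightarrow> complex^'d"
  where
  "isotypic_projection \<mu> s V \<delta> \<tau> v = (LINT k|\<mu>. chi s V \<delta> (matrix_inv k) *s \<tau> (embed_SO k) v)"

definition isotypic_subspace ::
  "(real^'n^'n) measure \<Rightarrow>
   (complex \<Rightarrow> 'v \<Rightarrow> 'v) \<Rightarrow> 'v::euclidean_space set \<Rightarrow> (real^'n^'n \<Rightarrow> 'v \<Rightarrow> 'v) \<Rightarrow>
   (real^('n option)^('n option) \<Rightarrow> complex^'d \<Rightarrow> complex^'d) \<Rightarrow> (complex^'d) set"
  where
  "isotypic_subspace \<mu> s V \<delta> \<tau> = range (isotypic_projection \<mu> s V \<delta> \<tau>)"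

definition spherical_function ::
  "(real^'n^'n) measure \<Rightarrow>
   (complex \<Rightarrow> 'v \<Rightarrow> 'v) \<Rightarrow> 'v::euclidean_space set \<Rightarrow> (real^'n^'n \<Rightarrow> 'v \<Rightarrow> 'v) \<Rightarrow>
   (real^('n option)^('n option) \<Rightarrow> complex^'d \<Rightarrow> complex^'d) \<Rightarrow>
   real^('n option)^('n option) \<Rightarrow> complex^'d \<Rightarrow> complex^'d"
  where
  "spherical_function \<mu> s V \<delta> \<tau> g =
     (\<lambda>v \<in> isotypic_subspace \<mu> s V \<delta> \<tau>. isotypic_projection \<mu> s V \<delta> \<tau> (\<tau> g v))"

text \<open>
  The endomorphism of \<open>U\<close> that corresponds to the endomorphism \<open>T\<close> of \<open>f ` U\<close>
  under the bijection \<open>f\<close>.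
\<close>

definition transport :: "('u \<Rightarrow> 'w) \<Rightarrow> 'u set \<Rightarrow> ('w \<Rightarrow> 'w) \<Rightarrow> 'u \<Rightarrow> 'u" where
  "transport f U T = (\<lambda>u \<in> U. inv_into U f (T (f u)))"

definition block_matrix ::
  "('u \<Rightarrow> 'u) \<Rightarrow> ('u \<Rightarrow> 'u) \<Rightarrow> ('u \<Rightarrow> 'u) \<Rightarrow> ('u \<Rightarrow> 'u) \<Rightarrow> 'u::plus \<times> 'u \<Rightarrow> 'u \<times> 'u" where
  "block_matrix A B C D = (\<lambda>(v, w). (A v + B w, C v + D w))"

end

theory Submission
  imports Defs "HOL-Computational_Algebra.Fundamental_Theorem_Algebra"
begin

text \<open>
  Write T for the unitary involution \<open>\<tau>(a)\<close>, V for the space of \<open>\<pi>\<close> and U = V + T V. Since a normalizes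
  SO(n), the operator T carries \<open>\<pi>\<^sub>\<phi>\<close> on V to the action of SO(n) on T V. As \<open>\<pi>\<close> and \<open>\<pi>\<^sub>\<phi>\<close> are
  inequivalent, Schur's lemma leaves no nonzero intertwiner between them. This gives that V and T V
  are orthogonal and that U is irreducible under O(n): an invariant subspace W of U has an equivariant
  orthogonal projection, which maps V into V and hence contains V or is orthogonal to it
  (\<open>irreducible_U\<close>). The map (v, w) to v + T w is then an equivalence of \<open>\<gamma>\<close> with U.

  The statement on spherical functions rests on multiplicity one: the isotypic subspaces of \<open>\<pi>\<close>,
  \<open>\<pi>\<^sub>\<phi>\<close> and \<open>\<gamma>\<close> are exactly V, T V and U. Because n is even, every g in
  SO(n+1) is conjugate to its inverse by an element of O(n) (\<open>SO_inverted_by_Orth\<close>): some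
  isometry fixes the last basis vector and conjugates g to its inverse, and it or its negative lies in
  the image of O(n). Gelfand's trick (\<open>gelfand_commuting\<close>) then shows that the
  operators commuting with O(n) form a commutative algebra. Commuting with the projection onto U, they
  preserve U, so U is the only copy of itself (\<open>Orth_equivariant_preserves_U\<close>). For SO(n), an
  equivariant operator restricted to V extends to an O(n)-equivariant operator, hence maps V into U, and
  then into V, again because there is no intertwiner to T V (\<open>SO_equivariant_preserves_V\<close>). Gelfand's
  trick rests on Burnside's theorem (\<open>burnside_trace\<close>).

  Multiplicity one makes the character integral the orthogonal projection onto the isotypic
  subspace (\<open>character_projection\<close>). The projection onto U is the sum of the projections
  onto the orthogonal subspaces V and T V, and reading it in the coordinates (v, w) gives the block
  matrix.
\<close>

section \<open>Complex linear maps and orthogonal projections\<close>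

abbreviation complex_linear :: "(complex^'d \<Rightarrow> complex^'d) \<Rightarrow> bool" where
  "complex_linear \<equiv> Vector_Spaces.linear (*s) (*s)"

lemma complex_linearI:
  assumes "\<And>x y. A (x + y) = A x + A y" and "\<And>c x. A (c *s x) = c *s A x"
  shows "complex_linear A"
  unfolding Vector_Spaces.linear_iff using assms vec.vector_space_axioms by auto

lemma complex_linearD:
  assumes "complex_linear A"
  shows "A (x + y) = A x + A y" and "A (c *s x) = c *s A x" and "A 0 = 0"
    and "A (x - y) = A x - A y" and "A (sum h S) = (\<Sum>i\<in>S. A (h i))"
proof -
  interpret Vector_Spaces.linear "(*s)" "(*s)" A by (rule assms)
  show "A (x + y) = A x + A y" "A (c *s x) = c *s A x" "A 0 = 0" "A (x - y) = A x - A y"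
    "A (sum h S) = (\<Sum>i\<in>S. A (h i))"
    by (simp_all add: add scale diff sum zero)
qed

lemma complex_linear_comp:
  "complex_linear A \<Longrightarrow> complex_linear B \<Longrightarrow> complex_linear (\<lambda>x. A (B x))"
  by (intro complex_linearI) (simp_all add: complex_linearD)

lemma scaleR_eq_complex_scale: "r *\<^sub>R x = complex_of_real r *s (x :: complex^'d)"
  by (vector scaleR_conv_of_real)

lemma complex_linear_imp_linear: "complex_linear A \<Longrightarrow> linear A"
  by (intro linearI) (simp_all add: complex_linearD scaleR_eq_complex_scale)

lemma complex_subspace_imp_subspace: "vec.subspace W \<Longrightarrow> subspace (W :: (complex^'d) set)"
  unfolding vec.subspace_def subspace_def by (simp add: scaleR_eq_complex_scale)

text \<open>
  The real inner product of \<^typ>\<open>complex^'d\<close> is the real part of the hermitian form. For complex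
  subspaces the two notions of orthogonality agree, so orthogonal complements and projections can be
  taken from the theory of real euclidean spaces.
\<close>

lemma inner_complex_vec_eq_Re_herm: "x \<bullet> y = Re (herm x y)"
  by (simp add: inner_vec_def herm_def inner_complex_def)

lemma inner_complex_scale: "(c *s x) \<bullet> y = x \<bullet> (cnj c *s (y :: complex^'d))"
  by (simp add: inner_complex_vec_eq_Re_herm herm_def mult.assoc mult.left_commute)

definition orth_proj :: "'v::euclidean_space set \<Rightarrow> 'v \<Rightarrow> 'v" where
  "orth_proj U x = (SOME u. u \<in> U \<and> (\<forall>w\<in>U. (x - u) \<bullet> w = 0))"

lemma orth_proj:
  assumes "subspace U"
  shows "orth_proj U x \<in> U" and "w \<in> U \<Longrightarrow> (x - orth_proj U x) \<bullet> w = 0"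
proof -
  obtain y z where "y \<in> span U" "\<And>w. w \<in> span U \<Longrightarrow> orthogonal z w" "x = y + z"
    using orthogonal_subspace_decomp_exists by blast
  then have "y \<in> U \<and> (\<forall>w\<in>U. (x - y) \<bullet> w = 0)"
    using assms by (simp add: span_eq_iff[THEN iffD2] orthogonal_def)
  then have "orth_proj U x \<in> U \<and> (\<forall>w\<in>U. (x - orth_proj U x) \<bullet> w = 0)"
    unfolding orth_proj_def by (rule someI)
  then show "orth_proj U x \<in> U" and "w \<in> U \<Longrightarrow> (x - orth_proj U x) \<bullet> w = 0" by auto
qed

lemma orth_proj_eqI:
  assumes "subspace U" and "u \<in> U" and "\<And>w. w \<in> U \<Longrightarrow> (x - u) \<bullet> w = 0"
  shows "orth_proj U x = u"
proof -
  let ?d = "orth_proj U x - u"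
  have "?d \<in> U" using assms orth_proj(1) subspace_diff by blast
  moreover have "?d = (x - u) - (x - orth_proj U x)" by simp
  ultimately have "?d \<bullet> ?d = 0"
    using assms orth_proj(2)[OF assms(1)] by (metis diff_zero inner_diff_left)
  then show ?thesis by simp
qed

lemma orth_proj_of_member: "subspace U \<Longrightarrow> x \<in> U \<Longrightarrow> orth_proj U x = x"
  by (rule orth_proj_eqI) auto

lemma orth_proj_of_orthogonal:
  "subspace U \<Longrightarrow> (\<And>w. w \<in> U \<Longrightarrow> x \<bullet> w = 0) \<Longrightarrow> orth_proj U x = 0"
  by (rule orth_proj_eqI) (auto simp: subspace_0)

lemma complex_linear_orth_proj:
  assumes "vec.subspace (U :: (complex^'d) set)"
  shows "complex_linear (orth_proj U)"
proof (rule complex_linearI)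
  have U: "subspace U" using assms by (rule complex_subspace_imp_subspace)
  show "orth_proj U (x + y) = orth_proj U x + orth_proj U y" for x y
  proof (rule orth_proj_eqI[OF U])
    show "orth_proj U x + orth_proj U y \<in> U" by (intro subspace_add U orth_proj(1))
    fix w assume "w \<in> U"
    moreover have "x + y - (orth_proj U x + orth_proj U y) = (x - orth_proj U x) + (y - orth_proj U y)"
      by simp
    ultimately show "(x + y - (orth_proj U x + orth_proj U y)) \<bullet> w = 0"
      by (simp only: inner_add_left orth_proj(2)[OF U])
  qed
  show "orth_proj U (c *s x) = c *s orth_proj U x" for c x
  proof (rule orth_proj_eqI[OF U])
    show "c *s orth_proj U x \<in> U" using assms orth_proj(1)[OF U] by (rule vec.subspace_scale)
    fix w assume "w \<in> U"
    then have "(x - orth_proj U x) \<bullet> (cnj c *s w) = 0"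
      using assms orth_proj(2)[OF U] vec.subspace_scale by blast
    moreover have "c *s x - c *s orth_proj U x = c *s (x - orth_proj U x)"
      by (simp add: vec.scale_right_diff_distrib)
    ultimately show "(c *s x - c *s orth_proj U x) \<bullet> w = 0"
      by (simp only: inner_complex_scale)
  qed
qed

text \<open>
  An operator whose adjoint also preserves \<open>U\<close> preserves the orthogonal complement of \<open>U\<close>.
\<close>

lemma orth_proj_commute:
  assumes U: "subspace U" and S: "linear S" and S': "linear S'"
    and adj: "\<And>x y. S x \<bullet> y = x \<bullet> S' y"
    and inv: "\<And>u. u \<in> U \<Longrightarrow> S u \<in> U" "\<And>u. u \<in> U \<Longrightarrow> S' u \<in> U"
  shows "orth_proj U (S x) = S (orth_proj U x)"
  using assms orth_proj[OF U] by (intro orth_proj_eqI U) (auto simp: linear_diff[OF S, symmetric])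

section \<open>Eigenvectors and Schur's lemma\<close>

text \<open>
  The vector p(A) u in Horner form, so that \<open>poly_apply\<close> follows the recursion on \<^const>\<open>pCons\<close>.
\<close>

definition poly_apply :: "(complex^'d \<Rightarrow> complex^'d) \<Rightarrow> complex poly \<Rightarrow> complex^'d \<Rightarrow> complex^'d" where
  "poly_apply A p u = fold_coeffs (\<lambda>c v. c *s u + A v) p 0"

context
  fixes A :: "complex^'d \<Rightarrow> complex^'d"
  assumes A: "complex_linear A"
begin

lemma poly_apply_0: "poly_apply A 0 u = 0"
  by (simp add: poly_apply_def)

lemma poly_apply_pCons: "poly_apply A (pCons c p) u = c *s u + A (poly_apply A p u)"
  using complex_linearD(3)[OF A] by (cases "p = 0 \<and> c = 0") (auto simp: poly_apply_def)

lemma poly_apply_add: "poly_apply A (p + q) u = poly_apply A p u + poly_apply A q u"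
  by (induction p q rule: poly_induct2)
    (simp_all add: poly_apply_0 poly_apply_pCons complex_linearD[OF A] vec.scale_left_distrib)

lemma poly_apply_smult: "poly_apply A (smult c p) u = c *s poly_apply A p u"
  by (induction p)
    (simp_all add: poly_apply_0 poly_apply_pCons complex_linearD[OF A] vec.scale_right_distrib)

lemma poly_apply_sum: "poly_apply A (\<Sum>i\<in>S. p i) u = (\<Sum>i\<in>S. poly_apply A (p i) u)"
  by (induction S rule: infinite_finite_induct) (simp_all add: poly_apply_0 poly_apply_add)

lemma poly_apply_monom: "poly_apply A (monom c i) u = c *s (A ^^ i) u"
proof (induction i)
  case 0
  then show ?case
    by (simp add: monom_0 poly_apply_pCons poly_apply_0 complex_linearD[OF A])
next
  case (Suc i)
  then show ?case
    by (simp add: monom_Suc poly_apply_pCons complex_linearD[OF A])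
qed

lemma poly_apply_linear_factor:
  "poly_apply A ([:- c, 1:] * p) u = A (poly_apply A p u) - c *s poly_apply A p u"
proof -
  have "[:- c, 1:] * p = pCons 0 p + smult (- c) p" by simp
  then show ?thesis
    by (simp only: poly_apply_add poly_apply_smult poly_apply_pCons) simp
qed

lemma poly_apply_mem:
  assumes "vec.subspace U" and "\<And>x. x \<in> U \<Longrightarrow> A x \<in> U" and "u \<in> U"
  shows "poly_apply A p u \<in> U"
  by (induction p)
    (auto simp: poly_apply_0 poly_apply_pCons assms vec.subspace_0 vec.subspace_add vec.subspace_scale)

text \<open>
  In finite dimension the vectors u, A u, A (A u), ... are dependent or repeat. Dependence is a
  property of the set of these vectors, so a repetition is a case of its own.
\<close>

lemma annihilating_poly_exists: "\<exists>p. p \<noteq> 0 \<and> poly_apply A p u = 0"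
proof (cases "inj (\<lambda>i. (A ^^ i) u)")
  case True
  let ?f = "\<lambda>i. (A ^^ i) u"
  have "infinite (range ?f)" using True finite_imageD by blast
  then have "vec.dependent (range ?f)" using vec.finiteI_independent by blast
  then obtain t g v where t: "finite t" "t \<subseteq> range ?f" "(\<Sum>v\<in>t. g v *s v) = 0" "v \<in> t" "g v \<noteq> 0"
    unfolding vec.dependent_explicit by blast
  let ?i = "inv_into UNIV ?f"
  let ?p = "\<Sum>v\<in>t. monom (g v) (?i v)"
  have fi: "?f (?i w) = w" if "w \<in> t" for w using that t(2) f_inv_into_f[of w ?f UNIV] by blast
  have "poly_apply A ?p u = 0"
    using fi t(3) by (simp add: poly_apply_sum poly_apply_monom)
  moreover have "coeff ?p (?i v) = (\<Sum>w\<in>t. if w = v then g w else 0)"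
    unfolding coeff_sum coeff_monom using fi t(4) by (intro sum.cong) (auto, metis)
  then have "?p \<noteq> 0" using t by auto
  ultimately show ?thesis by blast
next
  case False
  then obtain i j where "i \<noteq> j" "(A ^^ i) u = (A ^^ j) u" unfolding inj_def by blast
  then have "poly_apply A (monom 1 i + monom (- 1) j) u = 0"
    by (simp add: poly_apply_add poly_apply_monom vec.scale_minus_left)
  moreover have "coeff (monom 1 i + monom (- 1) j :: complex poly) i \<noteq> 0"
    using \<open>i \<noteq> j\<close> by simp
  then have "monom 1 i + monom (- 1) j \<noteq> (0 :: complex poly)" by fastforce
  ultimately show ?thesis by blast
qed

text \<open>
  Take a nonzero polynomial p of least degree that annihilates some nonzero vector of \<open>U\<close>. Over the
  complex numbers it has a linear factor X - c, and the complementary factor maps the vector to a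
  nonzero eigenvector, by minimality.
\<close>

lemma eigenvector_exists:
  assumes U: "vec.subspace U" "U \<noteq> {0}" and inv: "\<And>x. x \<in> U \<Longrightarrow> A x \<in> U"
  obtains c u where "u \<in> U" and "u \<noteq> 0" and "A u = c *s u"
proof -
  let ?P = "\<lambda>p. p \<noteq> 0 \<and> (\<exists>u\<in>U. u \<noteq> 0 \<and> poly_apply A p u = 0)"
  obtain u0 where "u0 \<in> U" "u0 \<noteq> 0" using U vec.subspace_0 by blast
  then have "\<exists>p. ?P p" using annihilating_poly_exists by blast
  then obtain p where p: "?P p" and min: "\<And>q. ?P q \<Longrightarrow> degree p \<le> degree q"
    using ex_has_least_nat[of ?P _ degree] by blast
  obtain u where u: "u \<in> U" "u \<noteq> 0" "poly_apply A p u = 0" using p by blast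
  have "degree p \<noteq> 0"
  proof
    assume "degree p = 0"
    then obtain c where "p = [:c:]" by (rule degree_eq_zeroE)
    then show False using p u by (auto simp: poly_apply_pCons poly_apply_0 complex_linearD[OF A])
  qed
  then have "\<not> constant (poly p)" by (simp add: constant_degree)
  then obtain c where "poly p c = 0" using fundamental_theorem_of_algebra by blast
  then obtain q where q: "p = [:- c, 1:] * q" by (metis dvdE poly_eq_0_iff_dvd)
  with p have "q \<noteq> 0" by auto
  then have "degree p = degree q + 1" unfolding q by (subst degree_mult_eq) auto
  then have "\<not> ?P q" using min by fastforce
  with \<open>q \<noteq> 0\<close> u have "poly_apply A q u \<noteq> 0" by blast
  moreover have "poly_apply A q u \<in> U" using poly_apply_mem U inv u by blast
  moreover have "A (poly_apply A q u) = c *s poly_apply A q u"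
    using u(3) unfolding q poly_apply_linear_factor by simp
  ultimately show thesis using that by blast
qed

end

text \<open>
  Irreducibility depends only on the set of operators. This form suits both a set of matrices and a
  representation composed with an automorphism of its group.
\<close>

definition irreducible_under :: "(complex^'d \<Rightarrow> complex^'d) set \<Rightarrow> (complex^'d) set \<Rightarrow> bool" where
  "irreducible_under S U \<longleftrightarrow> vec.subspace U \<and> U \<noteq> {0} \<and>
     (\<forall>W. vec.subspace W \<and> W \<subseteq> U \<and> (\<forall>s\<in>S. \<forall>w\<in>W. s w \<in> W) \<longrightarrow> W = {0} \<or> W = U)"

lemma irreducible_underD:
  assumes "irreducible_under S U" and "vec.subspace W" and "W \<subseteq> U"
    and "\<And>s w. s \<in> S \<Longrightarrow> w \<in> W \<Longrightarrow> s w \<in> W"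
  shows "W = {0} \<or> W = U"
  using assms unfolding irreducible_under_def by blast

text \<open>
  An eigenspace of an operator that commutes with \<open>S\<close> is invariant under \<open>S\<close>.
\<close>

lemma schur_scalar:
  assumes irr: "irreducible_under S U" and S: "\<And>s. s \<in> S \<Longrightarrow> complex_linear s"
    and SU: "\<And>s x. s \<in> S \<Longrightarrow> x \<in> U \<Longrightarrow> s x \<in> U"
    and A: "complex_linear A" "\<And>x. x \<in> U \<Longrightarrow> A x \<in> U"
    and comm: "\<And>s x. s \<in> S \<Longrightarrow> x \<in> U \<Longrightarrow> A (s x) = s (A x)"
  obtains c where "\<And>x. x \<in> U \<Longrightarrow> A x = c *s x"
proof -
  have U: "vec.subspace U" "U \<noteq> {0}" using irr unfolding irreducible_under_def by auto
  obtain c u where u: "u \<in> U" "u \<noteq> 0" "A u = c *s u"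
    using eigenvector_exists[OF A(1) U A(2)] by blast
  let ?W = "{x \<in> U. A x = c *s x}"
  have "?W = {0} \<or> ?W = U"
  proof (rule irreducible_underD[OF irr])
    show "vec.subspace ?W"
      using U(1) unfolding vec.subspace_def
      by (auto simp: complex_linearD[OF A(1)] vec.scale_right_distrib mult.commute)
    show "s w \<in> ?W" if "s \<in> S" "w \<in> ?W" for s w
      using that SU comm complex_linearD(2)[OF S] by auto
  qed auto
  with u have "?W = U" by blast
  then show thesis using that by blast
qed

text \<open>
  Kernel and image of an intertwiner are invariant subspaces.
\<close>

lemma schur_zero_or_bijective:
  fixes s t :: "'k \<Rightarrow> complex^'d \<Rightarrow> complex^'d"
  assumes irr: "irreducible_under (s ` K) U" "irreducible_under (t ` K) V"
    and sU: "\<And>k x. k \<in> K \<Longrightarrow> x \<in> U \<Longrightarrow> s k x \<in> U"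
    and t0: "\<And>k. k \<in> K \<Longrightarrow> t k 0 = 0"
    and A: "complex_linear A" "\<And>x. x \<in> U \<Longrightarrow> A x \<in> V"
    and comm: "\<And>k x. k \<in> K \<Longrightarrow> x \<in> U \<Longrightarrow> A (s k x) = t k (A x)"
  shows "(\<forall>x\<in>U. A x = 0) \<or> bij_betw A U V"
proof -
  have U: "vec.subspace U" using irr unfolding irreducible_under_def by auto
  let ?W = "{x \<in> U. A x = 0}"
  have "?W = {0} \<or> ?W = U"
  proof (rule irreducible_underD[OF irr(1)])
    show "vec.subspace ?W"
      using U unfolding vec.subspace_def by (auto simp: complex_linearD[OF A(1)])
    show "s' w \<in> ?W" if "s' \<in> s ` K" "w \<in> ?W" for s' w
      using that sU comm t0 by auto
  qed auto
  moreover have "A ` U = {0} \<or> A ` U = V"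
  proof (rule irreducible_underD[OF irr(2)])
    show "vec.subspace (A ` U)"
      using U unfolding vec.subspace_def
      by (auto simp flip: complex_linearD(1,2)[OF A(1)]) (metis complex_linearD(3)[OF A(1)] image_eqI)
    show "t' w \<in> A ` U" if "t' \<in> t ` K" "w \<in> A ` U" for t' w
      using that sU by (auto simp flip: comm)
    show "A ` U \<subseteq> V" using A by auto
  qed
  moreover have "inj_on A U" if W: "?W = {0}"
  proof (rule inj_onI)
    fix x y assume xy: "x \<in> U" "y \<in> U" "A x = A y"
    then have "x - y \<in> ?W" using U by (simp add: vec.subspace_diff complex_linearD[OF A(1)])
    then show "x = y" using W by simp
  qed
  ultimately show ?thesis unfolding bij_betw_def by blast
qed

section \<open>Burnside's theorem and Gelfand's commutativity criterion\<close>

text \<open>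
  The type of complex matrices carries only real scalar multiplication; the complex multiple of a
  matrix is written as a product with a scalar matrix.
\<close>

lemma scale_matrix_vector: "(mat c :: complex^'d^'d) *v x = c *s x"
  by (simp add: matrix_vector_mult_def mat_def vec_eq_iff if_distrib if_distribR cong: if_cong)

lemma mat_commute: "mat c ** X = X ** mat (c :: complex)" for X :: "complex^'d^'d"
  by (simp add: matrix_eq flip: matrix_vector_mul_assoc)
    (simp add: scale_matrix_vector complex_linearD)

lemma trace_mat_mult: "trace (mat c ** X) = c * trace (X :: complex^'d^'d)"
  by (simp add: trace_def matrix_matrix_mult_def mat_def if_distrib if_distribR sum_distrib_left
      cong: if_cong)

lemma trace_mult_mat: "trace (A ** (mat c ** X)) = c * trace (A ** X)" for A X :: "complex^'d^'d"
  by (metis mat_commute matrix_mul_assoc trace_mat_mult)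

lemma scaleR_matrix_eq: "r *\<^sub>R X = mat (of_real r) ** (X :: complex^'d^'d)"
  by (simp add: vec_eq_iff matrix_matrix_mult_def mat_def if_distrib if_distribR
      scaleR_conv_of_real[where 'a = complex] cong: if_cong)

lemma linear_matrix_apply: "linear (\<lambda>X. X *v (x :: complex^'d) :: complex^'d)"
  by (rule linearI)
    (simp_all add: matrix_vector_mult_add_rdistrib scaleR_matrix_eq scaleR_eq_complex_scale
      scale_matrix_vector flip: matrix_vector_mul_assoc)

lemma matrix_vector_mult_basis_complex: "((X :: complex^'d^'d) *v axis j 1) $ i = X $ i $ j"
  by (simp add: matrix_vector_mult_def axis_def if_distrib cong: if_cong)

lemma matrix_add_rdistrib: "(X + Y) ** Z = X ** Z + Y ** Z"
  for X Y :: "'a::semiring_1^'n^'m"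
  by (simp add: vec_eq_iff matrix_matrix_mult_def distrib_right sum.distrib)

text \<open>
  Burnside's theorem in dual form: under the trace pairing no nonzero matrix is orthogonal to an
  irreducible monoid \<open>M\<close> of matrices. The matrices orthogonal to \<open>M\<close> form a space closed under left
  multiplication by \<open>M\<close>. In a minimal nonzero subspace \<open>\<X>\<close> with this property, evaluation at a suitable
  vector \<open>x\<close> is an isomorphism onto the whole space; let \<open>I\<close> be its inverse. For each \<open>y\<close> the map
  \<open>v \<mapsto> I v *v y\<close> commutes with \<open>M\<close>, so Schur's lemma makes it a scalar \<open>l y\<close>. Hence \<open>I v\<close> is the
  rank one matrix \<open>y \<mapsto> l y *s v\<close>, whose trace is \<open>l v\<close>; pairing with the unit matrix gives \<open>l = 0\<close>.
\<close>

lemma burnside_trace: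
  fixes M :: "(complex^'d^'d) set"
  assumes irr: "irreducible_under ((*v) ` M) UNIV"
    and one: "mat 1 \<in> M" and mult: "\<And>X Y. X \<in> M \<Longrightarrow> Y \<in> M \<Longrightarrow> X ** Y \<in> M"
    and Z: "\<And>X. X \<in> M \<Longrightarrow> trace (Z ** X) = 0"
  shows "Z = 0"
proof (rule ccontr)
  assume "Z \<noteq> 0"
  define good where "good \<X> \<longleftrightarrow> subspace \<X> \<and> \<X> \<noteq> {0} \<and> (\<forall>Z\<in>\<X>. \<forall>X\<in>M. trace (Z ** X) = 0) \<and>
      (\<forall>Z\<in>\<X>. \<forall>X\<in>M. X ** Z \<in> \<X>) \<and> (\<forall>Z\<in>\<X>. \<forall>c. mat c ** Z \<in> \<X>)" for \<X> :: "(complex^'d^'d) set"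
  let ?all = "{Z. \<forall>X\<in>M. trace (Z ** X) = 0}"
  have "good ?all"
    unfolding good_def
  proof (intro conjI ballI allI)
    have "trace (mat c ** W ** X) = c * trace (W ** X)" for c and W X :: "complex^'d^'d"
      by (metis matrix_mul_assoc trace_mat_mult)
    then show "subspace ?all" and scale: "\<And>c W. W \<in> ?all \<Longrightarrow> mat c ** W \<in> ?all"
      unfolding subspace_def
      by (auto simp: scaleR_matrix_eq trace_add matrix_add_rdistrib) (simp add: trace_def)
    show "?all \<noteq> {0}" using Z \<open>Z \<noteq> 0\<close> by auto
    show "X ** W \<in> ?all" if "W \<in> ?all" "X \<in> M" for W X
    proof -
      have "trace (X ** W ** Y) = trace (W ** (Y ** X))" for Y
        by (metis matrix_mul_assoc trace_mul_sym)
      then show ?thesis using that mult by auto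
    qed
  qed auto
  then obtain \<X> where \<X>: "good \<X>" and min: "\<And>\<Y>. good \<Y> \<Longrightarrow> dim \<X> \<le> dim \<Y>"
    using ex_has_least_nat[of good _ dim] by blast
  have sub: "subspace \<X>" and tr: "\<And>W X. W \<in> \<X> \<Longrightarrow> X \<in> M \<Longrightarrow> trace (W ** X) = 0"
    and left: "\<And>W X. W \<in> \<X> \<Longrightarrow> X \<in> M \<Longrightarrow> X ** W \<in> \<X>"
    and sc: "\<And>W c. W \<in> \<X> \<Longrightarrow> mat c ** W \<in> \<X>" and "\<X> \<noteq> {0}"
    using \<X> unfolding good_def by auto
  then obtain W where "W \<in> \<X>" "W \<noteq> 0" using subspace_0 by blast
  then obtain x where x: "W *v x \<noteq> 0" by (metis matrix_eq matrix_vector_mult_0)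
  let ?e = "\<lambda>X :: complex^'d^'d. X *v x"
  have lin: "linear ?e" by (rule linear_matrix_apply)
  \<comment> \<open>The members of \<open>\<X>\<close> that kill \<open>x\<close> form a smaller space of the same kind, so minimality makes
     evaluation at \<open>x\<close> injective; by irreducibility it is also surjective.\<close>
  have inj: "inj_on ?e \<X>"
  proof -
    let ?K = "{X \<in> \<X>. X *v x = 0}"
    have "?K = {0}"
    proof (rule ccontr)
      assume "?K \<noteq> {0}"
      have "subspace ?K"
        using subspace_inter[OF sub linear_subspace_vimage[OF lin subspace_single_0]]
        by (simp add: vimage_def Int_def)
      then have "good ?K"
        unfolding good_def using \<open>?K \<noteq> {0}\<close> tr left sc
        by (auto simp: scale_matrix_vector simp flip: matrix_vector_mul_assoc)
      then have "dim \<X> \<le> dim ?K" by (rule min)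
      then have "?K = \<X>" using subspace_dim_equal[OF \<open>subspace ?K\<close> sub] by blast
      then show False using \<open>W \<in> \<X>\<close> x by blast
    qed
    then show ?thesis
      using sub by (subst linear_injective_on_subspace_0[OF lin sub]) auto
  qed
  have "?e ` \<X> = {0} \<or> ?e ` \<X> = UNIV"
  proof (rule irreducible_underD[OF irr])
    show "vec.subspace (?e ` \<X>)"
      unfolding vec.subspace_def
    proof (intro conjI ballI allI)
      have sp: "subspace (?e ` \<X>)" using lin sub by (rule linear_subspace_image)
      then show "0 \<in> ?e ` \<X>" by (rule subspace_0)
      show "y + z \<in> ?e ` \<X>" if "y \<in> ?e ` \<X>" "z \<in> ?e ` \<X>" for y z
        using sp that by (rule subspace_add)
      show "c *s y \<in> ?e ` \<X>" if "y \<in> ?e ` \<X>" for c y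
        using that sc[of _ c] by (auto simp flip: scale_matrix_vector simp: matrix_vector_mul_assoc)
    qed
    show "s w \<in> ?e ` \<X>" if "s \<in> (*v) ` M" "w \<in> ?e ` \<X>" for s w
      using that left by (auto simp: matrix_vector_mul_assoc)
  qed auto
  with x \<open>W \<in> \<X>\<close> have surj: "?e ` \<X> = UNIV" by blast
  define I where "I = inv_into \<X> ?e"
  have I: "I v \<in> \<X>" "I v *v x = v" for v
    using surj unfolding I_def by (auto intro: inv_into_into f_inv_into_f)
  have I_eq: "I v = Y" if "Y \<in> \<X>" "Y *v x = v" for v Y
    using inj_onD[OF inj, of "I v" Y] that I by auto
  have I_add: "I (v + w) = I v + I w" for v w
    using I sub by (intro I_eq) (auto intro: subspace_add simp: matrix_vector_mult_add_rdistrib)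
  have I_scale: "I (c *s v) = mat c ** I v" for c v
    using I sc by (intro I_eq) (auto simp: scale_matrix_vector simp flip: matrix_vector_mul_assoc)
  have I_mult: "I (X *v v) = X ** I v" if "X \<in> M" for X v
    using I left that by (intro I_eq) (auto simp flip: matrix_vector_mul_assoc)
  have "\<exists>c. \<forall>v. I v *v y = c *s v" for y
  proof -
    have lin: "complex_linear (\<lambda>v. I v *v y)"
      by (rule complex_linearI)
        (simp_all add: I_add I_scale matrix_vector_mult_add_rdistrib scale_matrix_vector
          flip: matrix_vector_mul_assoc)
    have comm: "I (s v) *v y = s (I v *v y)" if "s \<in> (*v) ` M" for s v
      using that by (auto simp: I_mult matrix_vector_mul_assoc)
    obtain c where "\<And>v. v \<in> UNIV \<Longrightarrow> I v *v y = c *s v"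
      by (rule schur_scalar[OF irr _ _ lin _ comm]) auto
    then show ?thesis by blast
  qed
  then obtain l where l: "\<And>y v. I v *v y = l y *s v" by metis
  have "l (axis j 1) = 0" for j
  proof -
    have "trace (I (axis j 1)) = (\<Sum>i\<in>UNIV. (I (axis j 1) *v axis i 1) $ i)"
      by (simp add: trace_def matrix_vector_mult_basis_complex)
    also have "\<dots> = (\<Sum>i\<in>UNIV. if i = j then l (axis i 1) else 0)"
      unfolding l by (intro sum.cong) (auto simp: axis_def)
    finally show ?thesis using tr[OF I(1) one, of "axis j 1"] by simp
  qed
  then have "I (W *v x) *v axis j 1 = 0" for j unfolding l by simp
  then have "I (W *v x) = 0"
    by (simp add: vec_eq_iff matrix_vector_mult_basis_complex)
  then show False using I(2)[of "W *v x"] x by simp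
qed

text \<open>
  The linear extension of inversion from \<open>M\<close> to its span, represented by its graph: as a relation
  it exists even before one knows that the extension is single-valued. Like inversion, it reverses
  products.
\<close>

inductive formal_inverse :: "(complex^'d^'d) set \<Rightarrow> complex^'d^'d \<Rightarrow> complex^'d^'d \<Rightarrow> bool" for M where
  base: "X \<in> M \<Longrightarrow> Y \<in> M \<Longrightarrow> X ** Y = mat 1 \<Longrightarrow> formal_inverse M X Y"
| add: "formal_inverse M X Y \<Longrightarrow> formal_inverse M X' Y' \<Longrightarrow> formal_inverse M (X + X') (Y + Y')"
| scale: "formal_inverse M X Y \<Longrightarrow> formal_inverse M (mat c ** X) (mat c ** Y)"

lemma matrix_inverse_swap: "X ** Y = mat 1 \<Longrightarrow> Y ** X = mat 1" for X Y :: "complex^'d^'d"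
  using matrix_left_right_inverse by blast

lemma formal_inverse_mult:
  assumes mult: "\<And>X Y. X \<in> M \<Longrightarrow> Y \<in> M \<Longrightarrow> X ** Y \<in> M"
    and "formal_inverse M X Y" and "formal_inverse M X' Y'"
  shows "formal_inverse M (X ** X') (Y' ** Y)"
  using assms(2)
proof induction
  case (base X Y)
  show ?case
    using assms(3)
  proof induction
    case (base X' Y')
    have "X ** X' ** (Y' ** Y) = X ** (X' ** Y') ** Y" by (simp only: matrix_mul_assoc)
    also have "\<dots> = mat 1" by (simp add: base \<open>X ** Y = mat 1\<close>)
    finally show ?case by (intro formal_inverse.base mult base \<open>X \<in> M\<close> \<open>Y \<in> M\<close>)
  next
    case (add X1 Y1 X2 Y2)
    then show ?case by (simp add: matrix_add_ldistrib matrix_add_rdistrib formal_inverse.add)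
  next
    case (scale X1 Y1 c)
    then have "formal_inverse M (mat c ** (X ** X1)) (mat c ** (Y1 ** Y))" by (intro formal_inverse.scale)
    then show ?case by (metis mat_commute matrix_mul_assoc)
  qed
next
  case (add X1 Y1 X2 Y2)
  then show ?case by (simp add: matrix_add_ldistrib matrix_add_rdistrib formal_inverse.add)
next
  case (scale X1 Y1 c)
  then have "formal_inverse M (mat c ** (X1 ** X')) (mat c ** (Y' ** Y1))" by (intro formal_inverse.scale)
  then show ?case by (metis mat_commute matrix_mul_assoc)
qed

lemma inner_matrix_eq_Re_trace:
  fixes X Y :: "complex^'d^'d"
  shows "X \<bullet> Y = Re (trace ((\<chi> i j. cnj (X $ j $ i)) ** Y))"
proof -
  have "trace ((\<chi> i j. cnj (X $ j $ i)) ** Y) = (\<Sum>j\<in>UNIV. \<Sum>i\<in>UNIV. cnj (X $ j $ i) * Y $ j $ i)"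
    unfolding trace_def matrix_matrix_mult_def by (simp, rule sum.swap)
  then show ?thesis by (simp add: inner_vec_def inner_complex_def)
qed

text \<open>
  By Burnside's theorem the span of \<open>M\<close> is the whole matrix algebra: a matrix that is orthogonal to
  this span for the real inner product is orthogonal to all complex multiples of members of \<open>M\<close>, so its
  conjugate transpose pairs to zero with \<open>M\<close> under the trace.
\<close>

lemma formal_inverse_exists:
  fixes M :: "(complex^'d^'d) set"
  assumes irr: "irreducible_under ((*v) ` M) UNIV"
    and one: "mat 1 \<in> M" and mult: "\<And>X Y. X \<in> M \<Longrightarrow> Y \<in> M \<Longrightarrow> X ** Y \<in> M"
    and inv: "\<And>X. X \<in> M \<Longrightarrow> \<exists>Y\<in>M. X ** Y = mat 1"
  shows "\<exists>Y. formal_inverse M X Y"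
proof -
  let ?S = "{X. \<exists>Y. formal_inverse M X Y}"
  have base: "X \<in> ?S" if "X \<in> M" for X using inv[OF that] that formal_inverse.base by blast
  have sc: "mat c ** X \<in> ?S" if "X \<in> ?S" for c X using that formal_inverse.scale by blast
  have "subspace ?S"
    unfolding subspace_def
  proof (intro conjI ballI allI)
    have "mat 0 ** (mat 1 :: complex^'d^'d) \<in> ?S" using sc base one by blast
    moreover have "mat 0 ** (mat 1 :: complex^'d^'d) = 0"
      by (simp add: vec_eq_iff mat_def matrix_matrix_mult_def)
    ultimately show "0 \<in> ?S" by metis
    show "X + Y \<in> ?S" if "X \<in> ?S" "Y \<in> ?S" for X Y using that formal_inverse.add by blast
    show "r *\<^sub>R X \<in> ?S" if "X \<in> ?S" for r X using sc[OF that] by (simp add: scaleR_matrix_eq)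
  qed
  have "?S = UNIV"
  proof (rule ccontr)
    assume "?S \<noteq> UNIV"
    then obtain X where "X \<notin> ?S" by blast
    let ?Z = "X - orth_proj ?S X"
    have "?Z \<noteq> 0" using orth_proj(1)[OF \<open>subspace ?S\<close>, of X] \<open>X \<notin> ?S\<close> by auto
    have ort: "?Z \<bullet> Y = 0" if "Y \<in> ?S" for Y using orth_proj(2)[OF \<open>subspace ?S\<close> that] .
    let ?Zs = "(\<chi> i j. cnj (?Z $ j $ i)) :: complex^'d^'d"
    have "?Zs = 0"
    proof (rule burnside_trace[OF irr one mult])
      fix Y assume "Y \<in> M"
      have "Re (c * trace (?Zs ** Y)) = 0" for c
      proof -
        have "c * trace (?Zs ** Y) = trace (?Zs ** (mat c ** Y))"
          by (rule trace_mult_mat[symmetric])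
        then show ?thesis using ort[OF sc[OF base[OF \<open>Y \<in> M\<close>], of c]]
          by (simp only: inner_matrix_eq_Re_trace)
      qed
      from this[of 1] this[of "\<i>"] show "trace (?Zs ** Y) = 0" by (simp add: complex_eq_iff)
    qed
    then have "?Z $ i $ j = 0" for i j by (auto simp: vec_eq_iff)
    then have "?Z = 0" by (simp add: vec_eq_iff)
    with \<open>?Z \<noteq> 0\<close> show False by blast
  qed
  then show ?thesis by blast
qed

text \<open>
  Gelfand's trick. Let every member of \<open>M\<close> be conjugate to its inverse by a member of \<open>H\<close>. Then for a
  matrix \<open>A\<close> in the commutant of \<open>H\<close> the traces of \<open>A ** X\<close> and of \<open>A ** Y\<close> agree whenever \<open>Y\<close> is
  inverse to \<open>X\<close>. By Burnside's theorem the linear extension of inversion then fixes the commutant of \<open>H\<close>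
  pointwise. As it reverses products, the commutant is commutative.
\<close>

lemma gelfand_commuting:
  fixes M H :: "(complex^'d^'d) set"
  assumes irr: "irreducible_under ((*v) ` M) UNIV"
    and one: "mat 1 \<in> M" and mult: "\<And>X Y. X \<in> M \<Longrightarrow> Y \<in> M \<Longrightarrow> X ** Y \<in> M"
    and inv: "\<And>X. X \<in> M \<Longrightarrow> \<exists>Y\<in>M. X ** Y = mat 1"
    and conj: "\<And>X Y. X \<in> M \<Longrightarrow> Y \<in> M \<Longrightarrow> X ** Y = mat 1 \<Longrightarrow>
        \<exists>h\<in>H. \<exists>h'. h ** h' = mat 1 \<and> Y = h ** X ** h'"
    and F: "\<And>h. h \<in> H \<Longrightarrow> F ** h = h ** F" and F': "\<And>h. h \<in> H \<Longrightarrow> F' ** h = h ** F'"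
  shows "F ** F' = F' ** F"
proof -
  have conj_trace: "trace (A ** Y) = trace (A ** X)"
    if X: "X \<in> M" "Y \<in> M" "X ** Y = mat 1" and A: "\<And>h. h \<in> H \<Longrightarrow> A ** h = h ** A" for A X Y
  proof -
    obtain h h' where h: "h \<in> H" "h ** h' = mat 1" "Y = h ** X ** h'" using conj[OF X] by blast
    have "trace (A ** Y) = trace (h ** (A ** X ** h'))"
      unfolding h(3) by (metis A[OF h(1)] matrix_mul_assoc)
    also have "\<dots> = trace (A ** X ** (h' ** h))" by (metis matrix_mul_assoc trace_mul_sym)
    finally show ?thesis using h(2) matrix_inverse_swap by fastforce
  qed
  have trace_swap: "trace (B ** X) = trace (A ** Y)"
    if "formal_inverse M A B" and X: "X \<in> M" "Y \<in> M" "X ** Y = mat 1" for A B X Y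
    using that(1)
  proof induction
    case (base A B)
    have "Y ** A ** (B ** X) = Y ** (A ** B) ** X" by (simp only: matrix_mul_assoc)
    also have "\<dots> = mat 1" using base matrix_inverse_swap[OF X(3)] by simp
    finally have "trace (mat 1 ** (B ** X)) = trace (mat 1 ** (Y ** A))"
      using base X by (intro conj_trace mult) auto
    then show ?case using trace_mul_sym[of Y A] by simp
  next
    case (add A B A' B')
    then show ?case by (simp add: matrix_add_rdistrib trace_add)
  next
    case (scale A B c)
    then show ?case by (simp add: trace_mat_mult flip: matrix_mul_assoc)
  qed
  have sym: "B = A" if AB: "formal_inverse M A B" and A: "\<And>h. h \<in> H \<Longrightarrow> A ** h = h ** A" for A B
  proof -
    have "B - A = 0"
    proof (rule burnside_trace[OF irr one mult])
      fix X assume X: "X \<in> M"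
      obtain Y where Y: "Y \<in> M" "X ** Y = mat 1" using inv[OF X] by blast
      have "trace (B ** X) = trace (A ** X)"
        using trace_swap[OF AB X Y] conj_trace[OF X Y A] by simp
      moreover have "(B - A) ** X = B ** X - A ** X"
        by (metis add_diff_cancel diff_add_cancel matrix_add_rdistrib)
      ultimately show "trace ((B - A) ** X) = 0" by (simp add: trace_sub)
    qed
    then show ?thesis by simp
  qed
  obtain G G' where G: "formal_inverse M F G" "formal_inverse M F' G'"
    using formal_inverse_exists[OF irr one mult inv] by metis
  have "formal_inverse M (F ** F') (G' ** G)" by (rule formal_inverse_mult[OF mult G])
  then have "G' ** G = F ** F'"
    by (rule sym) (metis F F' matrix_mul_assoc)
  moreover have "G = F" "G' = F'" using sym[OF G(1) F] sym[OF G(2) F'] by blast+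
  ultimately show ?thesis by simp
qed

section \<open>Normal matrices are conjugate to their transposes by isometries fixing a vector\<close>

declare transpose_matrix_vector [simp del]

lemma transpose_zero: "transpose 0 = (0 :: real^'m^'m)"
  by (simp add: transpose_def vec_eq_iff)

text \<open>
  A partial isometry that is its own inverse and carries the action of each \<open>A\<close> in \<open>\<A>\<close> to that of its
  transpose, represented by its graph.
\<close>

definition reversal_relation :: "(real^'m^'m) set \<Rightarrow> ((real^'m) \<times> (real^'m)) set \<Rightarrow> bool" where
  "reversal_relation \<A> \<Gamma> \<longleftrightarrow> subspace \<Gamma> \<and> (\<forall>(x, y)\<in>\<Gamma>. x \<bullet> x = y \<bullet> y \<and> (y, x) \<in> \<Gamma> \<and>
     (\<forall>A\<in>\<A>. (A *v x, transpose A *v y) \<in> \<Gamma>))"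

lemma reversal_relationD:
  assumes "reversal_relation \<A> \<Gamma>"
  shows "subspace \<Gamma>" and "(x, y) \<in> \<Gamma> \<Longrightarrow> x \<bullet> x = y \<bullet> y" and "(x, y) \<in> \<Gamma> \<Longrightarrow> (y, x) \<in> \<Gamma>"
    and "(x, y) \<in> \<Gamma> \<Longrightarrow> A \<in> \<A> \<Longrightarrow> (A *v x, transpose A *v y) \<in> \<Gamma>"
  using assms unfolding reversal_relation_def by auto

lemma inner_transpose: "(A *v x) \<bullet> y = x \<bullet> (transpose A *v y)" for A :: "real^'m^'m"
  using dot_lmul_matrix[of x "transpose A" y] by simp

context
  fixes \<A> :: "(real^'m^'m) set"
  assumes sub: "subspace \<A>" and one: "mat 1 \<in> \<A>"
    and mult: "\<And>A B. A \<in> \<A> \<Longrightarrow> B \<in> \<A> \<Longrightarrow> A ** B \<in> \<A>"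
    and comm: "\<And>A B. A \<in> \<A> \<Longrightarrow> B \<in> \<A> \<Longrightarrow> A ** B = B ** A"
    and transp: "\<And>A. A \<in> \<A> \<Longrightarrow> transpose A \<in> \<A>"
begin

text \<open>
  On the cyclic space generated by \<open>u\<close> the reversal sends \<open>A *v u\<close> to \<open>transpose A *v u\<close>. It is an
  isometry because the commuting matrices \<open>A\<close> and \<open>transpose A\<close> satisfy
  \<open>(A *v u) \<bullet> (A *v u) = (transpose A *v u) \<bullet> (transpose A *v u)\<close>. If \<open>u\<close> is orthogonal to the domain of
  \<open>\<Gamma>\<close>, then so is its cyclic space, and the two partial isometries can be added.
\<close>

lemma reversal_relation_extend:
  assumes \<Gamma>: "reversal_relation \<A> \<Gamma>" and u: "\<And>x y. (x, y) \<in> \<Gamma> \<Longrightarrow> u \<bullet> x = 0"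
  shows "reversal_relation \<A> {(x + A *v u, y + transpose A *v u) |x y A. (x, y) \<in> \<Gamma> \<and> A \<in> \<A>}"
    (is "reversal_relation \<A> ?R")
proof -
  note G = reversal_relationD[OF \<Gamma>]
  have R: "(x + A *v u, y + transpose A *v u) \<in> ?R" if "(x, y) \<in> \<Gamma>" "A \<in> \<A>" for x y A
    using that by blast
  have "subspace ?R"
    unfolding subspace_def
  proof (intro conjI ballI allI)
    have "(0, 0) \<in> \<Gamma>" using G(1) subspace_0 by (metis zero_prod_def)
    note elem = R[OF this subspace_0[OF sub]]
    have eq: "0 = (0 + 0 *v u, 0 + transpose (0 :: real^'m^'m) *v u)"
      by (simp add: transpose_zero zero_prod_def)
    show "0 \<in> ?R" by (subst eq) (rule elem)
    fix p assume "p \<in> ?R"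
    then obtain x y A where p: "p = (x + A *v u, y + transpose A *v u)" "(x, y) \<in> \<Gamma>" "A \<in> \<A>"
      by blast
    show "r *\<^sub>R p \<in> ?R" for r
    proof -
      have "(r *\<^sub>R x, r *\<^sub>R y) \<in> \<Gamma>" using subspace_scale[OF G(1) p(2), of r] by simp
      note R[OF this subspace_scale[OF sub p(3), of r]]
      moreover have "r *\<^sub>R p = (r *\<^sub>R x + (r *\<^sub>R A) *v u, r *\<^sub>R y + transpose (r *\<^sub>R A) *v u)"
        by (simp add: p(1) scaleR_add_right scaleR_matrix_vector_assoc transpose_scalar
            del: transpose_matrix_vector)
      ultimately show ?thesis by (simp only:)
    qed
    fix q assume "q \<in> ?R"
    then obtain x' y' B where q: "q = (x' + B *v u, y' + transpose B *v u)" "(x', y') \<in> \<Gamma>" "B \<in> \<A>"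
      by blast
    have "(x + x', y + y') \<in> \<Gamma>" using subspace_add[OF G(1) p(2) q(2)] by simp
    note R[OF this subspace_add[OF sub p(3) q(3)]]
    moreover have "transpose (A + B) = transpose A + transpose B" by (simp add: transpose_def vec_eq_iff)
    then have "p + q = (x + x' + (A + B) *v u, y + y' + transpose (A + B) *v u)"
      by (simp add: p(1) q(1) matrix_vector_mult_add_rdistrib del: transpose_matrix_vector)
    ultimately show "p + q \<in> ?R" by (simp only:)
  qed
  moreover have "(x + A *v u) \<bullet> (x + A *v u) = (y + transpose A *v u) \<bullet> (y + transpose A *v u) \<and>
      (y + transpose A *v u, x + A *v u) \<in> ?R \<and>
      (\<forall>B\<in>\<A>. (B *v (x + A *v u), transpose B *v (y + transpose A *v u)) \<in> ?R)"
    if xy: "(x, y) \<in> \<Gamma>" and A: "A \<in> \<A>" for x y A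
  proof (intro conjI ballI)
    have ort: "(B *v u) \<bullet> z = 0" if "(z, w) \<in> \<Gamma>" "B \<in> \<A>" for z w B
      using u[OF G(4)[OF that(1) transp[OF that(2)]]] by (simp add: inner_transpose)
    have "(A *v u) \<bullet> (A *v u) = u \<bullet> ((transpose A ** A) *v u)"
      by (simp add: inner_transpose matrix_vector_mul_assoc)
    also have "\<dots> = u \<bullet> ((A ** transpose A) *v u)" using comm[OF A transp[OF A]] by simp
    also have "\<dots> = (transpose A *v u) \<bullet> (transpose A *v u)"
      by (simp add: inner_transpose matrix_vector_mul_assoc)
    finally show "(x + A *v u) \<bullet> (x + A *v u) = (y + transpose A *v u) \<bullet> (y + transpose A *v u)"
      using ort[OF xy A] ort[OF G(3)[OF xy] transp[OF A]] G(2)[OF xy]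
      by (simp add: inner_add_left inner_add_right inner_commute)
    show "(y + transpose A *v u, x + A *v u) \<in> ?R"
      using R[OF G(3)[OF xy] transp[OF A]] by simp
    fix B assume B: "B \<in> \<A>"
    have "transpose (B ** A) = transpose B ** transpose A"
      using comm[OF A B] by (metis matrix_transpose_mul)
    then show "(B *v (x + A *v u), transpose B *v (y + transpose A *v u)) \<in> ?R"
      using R[OF G(4)[OF xy B] mult[OF B A]]
      by (simp add: matrix_vector_right_distrib matrix_vector_mul_assoc)
  qed
  ultimately show ?thesis unfolding reversal_relation_def by auto
qed

text \<open>
  A reversal relation of maximal dimension containing \<open>(v, v)\<close> is the graph of a total isometry:
  otherwise it could be extended by a vector orthogonal to its domain.
\<close>

lemma reversal_exists:
  obtains h where "orthogonal_transformation h" and "h v = v"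
    and "\<And>A x. A \<in> \<A> \<Longrightarrow> h (A *v x) = transpose A *v h x"
proof -
  have "reversal_relation \<A> {0}" 
    unfolding reversal_relation_def by (intro conjI subspace_single_0) (simp add: zero_prod_def)
  note start = reversal_relation_extend[OF this, of v]
  let ?P = "\<lambda>\<Gamma>. reversal_relation \<A> \<Gamma> \<and> (v, v) \<in> \<Gamma>"
  have ex: "\<exists>\<Gamma>. ?P \<Gamma>"
  proof -
    let ?\<Gamma> = "{(x + A *v v, y + transpose A *v v) |x y A. (x, y) \<in> ({0} :: ((real^'m) \<times> (real^'m)) set) \<and> A \<in> \<A>}"
    have "reversal_relation \<A> ?\<Gamma>" by (rule start) (simp add: zero_prod_def)
    moreover have "(v, v) \<in> ?\<Gamma>"
      using one by (intro CollectI exI[of _ 0] exI[of _ "mat 1"]) (simp add: zero_prod_def)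
    ultimately show ?thesis by blast
  qed
  have "\<exists>\<Gamma>. ?P \<Gamma> \<and> (\<forall>\<Gamma>'. ?P \<Gamma>' \<longrightarrow> dim \<Gamma>' \<le> dim \<Gamma>)"
  proof -
    obtain \<Gamma>0 where "?P \<Gamma>0" using ex by blast
    moreover have "\<forall>\<Gamma>. ?P \<Gamma> \<longrightarrow> dim \<Gamma> < DIM((real^'m) \<times> (real^'m)) + 1"
      using dim_subset_UNIV less_Suc_eq_le by (metis Suc_eq_plus1)
    ultimately show ?thesis by (rule ex_has_greatest_nat)
  qed
  then obtain \<Gamma> where \<Gamma>: "reversal_relation \<A> \<Gamma>" "(v, v) \<in> \<Gamma>"
    and max: "\<And>\<Gamma>'. reversal_relation \<A> \<Gamma>' \<Longrightarrow> (v, v) \<in> \<Gamma>' \<Longrightarrow> dim \<Gamma>' \<le> dim \<Gamma>" by blast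
  note G = reversal_relationD[OF \<Gamma>(1)]
  have subD: "subspace (fst ` \<Gamma>)" by (rule linear_subspace_image[OF linear_fst G(1)])
  have "fst ` \<Gamma> = UNIV"
  proof (rule ccontr)
    assume "fst ` \<Gamma> \<noteq> UNIV"
    then obtain z where "z \<notin> fst ` \<Gamma>" by blast
    define u where "u = z - orth_proj (fst ` \<Gamma>) z"
    have u: "u \<bullet> x = 0" if "(x, y) \<in> \<Gamma>" for x y
      using orth_proj(2)[OF subD, of x z] that unfolding u_def by force
    have "u \<notin> fst ` \<Gamma>"
    proof
      assume "u \<in> fst ` \<Gamma>"
      then have "u + orth_proj (fst ` \<Gamma>) z \<in> fst ` \<Gamma>" using subD orth_proj(1) subspace_add by blast
      then show False using \<open>z \<notin> fst ` \<Gamma>\<close> unfolding u_def by simp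
    qed
    let ?R = "{(x + A *v u, y + transpose A *v u) |x y A. (x, y) \<in> \<Gamma> \<and> A \<in> \<A>}"
    have R: "reversal_relation \<A> ?R" by (rule reversal_relation_extend[OF \<Gamma>(1) u])
    have "\<Gamma> \<subseteq> ?R"
    proof
      fix p assume "p \<in> \<Gamma>"
      then show "p \<in> ?R"
        using subspace_0[OF sub]
        by (intro CollectI exI[of _ "fst p"] exI[of _ "snd p"] exI[of _ 0]) (simp add: transpose_zero)
    qed
    moreover have "dim ?R \<le> dim \<Gamma>" using max[OF R] \<open>\<Gamma> \<subseteq> ?R\<close> \<Gamma>(2) by blast
    ultimately have "?R = \<Gamma>" using subspace_dim_equal[OF G(1) reversal_relationD(1)[OF R]] by blast
    moreover have "(0, 0) \<in> \<Gamma>" using subspace_0[OF G(1)] by (simp add: zero_prod_def)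
    then have "(0 + mat 1 *v u, 0 + transpose (mat 1) *v u) \<in> ?R" using one by blast
    ultimately have "(u, u) \<in> \<Gamma>" by simp
    then show False using \<open>u \<notin> fst ` \<Gamma>\<close> by force
  qed
  then have "\<exists>y. (x, y) \<in> \<Gamma>" for x by (metis UNIV_I imageE prod.collapse)
  then obtain h where h: "\<And>x. (x, h x) \<in> \<Gamma>" by metis
  have h_eq: "h x = y" if "(x, y) \<in> \<Gamma>" for x y
  proof -
    have "(x - x, h x - y) \<in> \<Gamma>" using subspace_diff[OF G(1) h[of x] that] by simp
    from G(2)[OF this] show ?thesis by simp
  qed
  have "linear h"
  proof (rule linearI)
    show "h (x + y) = h x + h y" for x y using subspace_add[OF G(1) h h] by (intro h_eq) simp
    show "h (r *\<^sub>R x) = r *\<^sub>R h x" for r x using subspace_scale[OF G(1) h] by (intro h_eq) simp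
  qed
  moreover have "norm (h x) = norm x" for x using G(2)[OF h] by (simp add: norm_eq_sqrt_inner)
  ultimately have "orthogonal_transformation h" by (simp add: orthogonal_transformation)
  then show thesis using h_eq[OF \<Gamma>(2)] h_eq[OF G(4)[OF h]] that by blast
qed

end

text \<open>
  The bicommutant \<open>?A\<close> of a normal matrix and its transpose is a commutative algebra that contains
  both and is closed under transposition, as the extension argument requires.
\<close>

lemma normal_matrix_reversal:
  fixes g :: "real^'m^'m"
  assumes normal: "transpose g ** g = g ** transpose g"
  obtains h where "orthogonal_matrix h" and "h *v v = v" and "h ** g = transpose g ** h"
proof -
  let ?C = "{X. X ** g = g ** X \<and> X ** transpose g = transpose g ** X}"
  let ?A = "{Y. \<forall>X\<in>?C. Y ** X = X ** Y}"
  have tr: "transpose A ** X = X ** transpose A" if "A ** transpose X = transpose X ** A" for A X :: "real^'m^'m"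
  proof -
    have "transpose A ** X = transpose (transpose X ** A)"
      by (simp only: matrix_transpose_mul transpose_transpose)
    also have "\<dots> = transpose (A ** transpose X)" by (simp only: that)
    also have "\<dots> = X ** transpose A" by (simp only: matrix_transpose_mul transpose_transpose)
    finally show ?thesis .
  qed
  have tC: "transpose X \<in> ?C" if "X \<in> ?C" for X
    using that tr[of X g] tr[of X "transpose g"] by (auto simp: transpose_transpose)
  have g: "g \<in> ?A" "g \<in> ?C" "transpose g \<in> ?C" using normal by auto
  have sub: "subspace ?A"
    unfolding subspace_def
    by (auto simp: matrix_add_ldistrib matrix_add_rdistrib matrix_scalar_ac
      simp flip: scalar_matrix_assoc)
  have comm: "A ** B = B ** A" if "A \<in> ?A" "B \<in> ?A" for A B
  proof -
    have "B \<in> ?C" using that(2) g by simp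
    then show ?thesis using that(1) by blast
  qed
  have transp: "transpose A \<in> ?A" if "A \<in> ?A" for A
    using that tC by (auto intro!: tr)
  have mult: "A ** B \<in> ?A" if AB: "A \<in> ?A" "B \<in> ?A" for A B
  proof -
    have "A ** B ** X = X ** (A ** B)" if "X \<in> ?C" for X
    proof -
      have "A ** X = X ** A" "B ** X = X ** B" using AB that by blast+
      then show ?thesis by (metis matrix_mul_assoc)
    qed
    then show ?thesis by blast
  qed
  have one: "mat 1 \<in> ?A" by simp
  obtain h where h: "orthogonal_transformation h" "h v = v"
    "\<And>A x. A \<in> ?A \<Longrightarrow> h (A *v x) = transpose A *v h x"
    by (rule reversal_exists[OF sub one mult comm transp, where v = v]) (assumption | rule that)+
  have lin: "linear h" using h(1) orthogonal_transformation_linear by blast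
  have "matrix h ** g = transpose g ** matrix h"
    using h(3)[OF g(1)] lin by (simp add: matrix_eq matrix_works flip: matrix_vector_mul_assoc)
  then show thesis
    using that[of "matrix h"] h lin by (simp add: orthogonal_transformation_matrix matrix_works)
qed

section \<open>The embedding of O(n) into SO(n+1)\<close>

lemma embed_SO_nth [simp]:
  "embed_SO k $ Some i $ Some j = k $ i $ j" "embed_SO k $ None $ None = det k"
  "embed_SO k $ Some i $ None = 0" "embed_SO k $ None $ Some i = 0"
  by (simp_all add: embed_SO_def)

lemma matrix_option_eqI:
  fixes A B :: "'a^('n::finite option)^('n option)"
  assumes "\<And>i j. A $ Some i $ Some j = B $ Some i $ Some j" and "A $ None $ None = B $ None $ None"
    and "\<And>i. A $ Some i $ None = B $ Some i $ None" and "\<And>i. A $ None $ Some i = B $ None $ Some i"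
  shows "A = B"
proof -
  have "A $ i $ j = B $ i $ j" for i j using assms by (cases i; cases j) auto
  then show ?thesis by (simp add: vec_eq_iff)
qed

lemma sum_option: "(\<Sum>i\<in>UNIV. f i) = f None + (\<Sum>i\<in>UNIV. f (Some i))"
  for f :: "'n::finite option \<Rightarrow> 'a::comm_monoid_add"
  by (simp add: UNIV_option_conv sum.reindex)

lemma embed_SO_mult: "embed_SO (k ** l) = embed_SO k ** embed_SO l"
  by (rule matrix_option_eqI) (simp_all add: matrix_matrix_mult_def sum_option det_mul[symmetric] del: det_mul)

lemma embed_SO_one: "embed_SO (mat 1) = mat 1"
  by (rule matrix_option_eqI) (simp_all add: mat_def[of 1], simp add: det_I[unfolded mat_def])

lemma embed_SO_transpose: "embed_SO (transpose k) = transpose (embed_SO k)"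
  by (rule matrix_option_eqI) (simp_all add: transpose_def det_transpose[unfolded transpose_def])

text \<open>
  Only the permutations that fix \<^const>\<open>None\<close> contribute to the determinant.
\<close>

lemma det_embed_SO: "det (embed_SO k) = det k * det k"
proof -
  let ?A = "embed_SO k"
  let ?t = "\<lambda>p. of_int (sign p) * (\<Prod>i\<in>UNIV. ?A $ i $ p i)"
  have zero: "?t p = 0" if "p permutes UNIV" "\<not> p permutes range Some" for p
  proof -
    have "p None \<noteq> None"
    proof
      assume "p None = None"
      then have "p permutes range Some"
        by (intro permutes_superset[OF that(1)]) (auto simp: UNIV_option_conv)
      then show False using that(2) by blast
    qed
    then obtain j where "p None = Some j" by auto
    then have "?A $ None $ p None = 0" by simp
    then have "(\<Prod>i\<in>UNIV. ?A $ i $ p i) = 0" by (intro prod_zero) auto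
    then show ?thesis by simp
  qed
  have bij: "bij_betw (map_permutation UNIV Some) {p. p permutes UNIV} {p. p permutes range Some}"
  proof -
    have "map_permutation UNIV Some =
        (\<lambda>q x. if x \<in> range Some then Some (q (inv_into UNIV Some x)) else x)"
      by (simp add: map_permutation_def restrict_id_def fun_eq_iff)
    then show ?thesis
      by (rule ssubst) (rule bij_betw_permutations, simp add: bij_betw_def)
  qed
  have "det ?A = (\<Sum>p | p permutes UNIV. ?t p)" by (simp add: det_def)
  also have "\<dots> = (\<Sum>p | p permutes range Some. ?t p)"
  proof (rule sum.mono_neutral_right)
    show "{p. p permutes range Some} \<subseteq> {p. p permutes (UNIV :: 'a option set)}"
      by (auto intro: permutes_subset)
    show "\<forall>p\<in>{p. p permutes UNIV} - {p. p permutes range Some}. ?t p = 0"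
      using zero by blast
  qed (rule finite_permutations, rule finite)
  also have "\<dots> = (\<Sum>q | q permutes UNIV. ?t (map_permutation UNIV Some q))"
    by (rule sum.reindex_bij_betw[OF bij, symmetric])
  also have "\<dots> = (\<Sum>q | q permutes UNIV. det k * (of_int (sign q) * (\<Prod>i\<in>UNIV. k $ i $ q i)))"
  proof (intro sum.cong refl)
    fix q :: "'a \<Rightarrow> 'a" assume "q \<in> {q. q permutes UNIV}"
    then have q: "q permutes UNIV" by simp
    let ?q = "map_permutation UNIV Some q"
    have "?q None = None" by (simp add: map_permutation_def restrict_id_def)
    moreover have "?q (Some i) = Some (q i)" for i by (simp add: map_permutation_apply)
    moreover have "sign ?q = sign q" using q by (simp add: sign_map_permutation)
    ultimately show "?t ?q = det k * (of_int (sign q) * (\<Prod>i\<in>UNIV. k $ i $ q i))"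
      by (simp add: UNIV_option_conv prod.reindex)
  qed
  also have "\<dots> = det k * det k" by (simp add: det_def sum_distrib_left)
  finally show ?thesis .
qed

lemma embed_SO_in_SO:
  assumes "k \<in> Orth"
  shows "embed_SO k \<in> SO"
proof -
  have "orthogonal_matrix k" using assms by (simp add: Orth_def)
  then have "transpose (embed_SO k) ** embed_SO k = mat 1"
    by (simp add: orthogonal_matrix_def embed_SO_one flip: embed_SO_transpose embed_SO_mult)
  moreover have "det k * det k = 1" using det_orthogonal_matrix[OF \<open>orthogonal_matrix k\<close>] by auto
  ultimately show ?thesis by (simp add: SO_def rotation_matrix_def orthogonal_matrix det_embed_SO)
qed

lemma continuous_on_det: "continuous_on S (det :: real^'n^'n \<Rightarrow> real)"
  unfolding det_def[abs_def] by (intro continuous_intros)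

lemma continuous_on_embed_SO: "continuous_on S (embed_SO :: real^'n^'n \<Rightarrow> _)"
proof -
  have "continuous_on S (\<lambda>k :: real^'n^'n. embed_SO k $ i $ j)" for i j
    by (cases i; cases j) (auto intro!: continuous_intros continuous_on_det)
  then have "continuous_on S (\<lambda>k. \<chi> i j. embed_SO (k :: real^'n^'n) $ i $ j)"
    by (intro continuous_on_vec_lambda)
  then show ?thesis by simp
qed

lemma det_minus: "det (- k) = (- 1) ^ CARD('n) * det (k :: real^'n^'n)"
  using det_rows_mul[of "\<lambda>_. - 1" "($) k"] by (simp add: vec_lambda_eta uminus_vec_def)

text \<open>
  An isometry \<open>h\<close> that reverses \<open>g\<close> and fixes the last basis vector is a block matrix diag (k, 1). If
  \<open>det k = 1\<close> it is the image of \<open>k\<close>. If \<open>det k = -1\<close>, then \<open>- h\<close>, which conjugates \<open>g\<close> in the same way,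
  is the image of \<open>- k\<close>; here \<open>det (- k) = det k\<close> because n is even.
\<close>

lemma SO_inverted_by_Orth:
  fixes g :: "real^('n::finite option)^('n option)"
  assumes "even CARD('n)" and "g \<in> SO"
  obtains k where "k \<in> Orth" and "transpose g = embed_SO k ** g ** embed_SO (transpose k)"
proof -
  let ?e = "axis None 1 :: real^('n option)"
  have g: "orthogonal_matrix g" using assms(2) by (simp add: SO_def rotation_matrix_def)
  then have "transpose g ** g = g ** transpose g" by (simp add: orthogonal_matrix_def)
  then obtain h where h: "orthogonal_matrix h" "h *v ?e = ?e" "h ** g = transpose g ** h"
    by (rule normal_matrix_reversal)
  have col: "h $ i $ None = ?e $ i" for i
    using arg_cong[OF h(2), of "\<lambda>x. x $ i"] by (simp add: matrix_vector_mult_basis column_def)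
  have "transpose h *v (h *v ?e) = ?e"
    using h(1) by (simp add: orthogonal_matrix_def matrix_vector_mul_assoc)
  then have "transpose h *v ?e = ?e" by (simp only: h(2))
  from arg_cong[OF this, of "\<lambda>x. x $ i" for i] have row: "h $ None $ i = ?e $ i" for i
    by (simp add: matrix_vector_mult_basis column_def transpose_def)
  define k where "k = (\<chi> i j. h $ Some i $ Some j)"
  have "transpose h ** h = mat 1" using h(1) by (simp add: orthogonal_matrix_def)
  then have "(transpose h ** h) $ Some i $ Some j = mat 1 $ Some i $ Some j" for i j by simp
  then have "transpose k ** k = mat 1"
    by (simp add: vec_eq_iff matrix_matrix_mult_def transpose_def sum_option k_def mat_def row axis_def)
  then have k: "orthogonal_matrix k" by (simp add: orthogonal_matrix)
  have "\<exists>k'\<in>Orth. embed_SO k' = h \<or> embed_SO k' = - h"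
  proof (cases "det k = 1")
    case True
    have "embed_SO k = h"
      by (rule matrix_option_eqI) (simp_all add: True col row axis_def, simp add: k_def)
    then show ?thesis using k by (auto simp: Orth_def)
  next
    case False
    then have "det (- k) = - 1"
      using det_orthogonal_matrix[OF k] assms(1) by (simp add: det_minus)
    then have "embed_SO (- k) = - h"
      by (intro matrix_option_eqI) (simp_all add: k_def col row axis_def)
    moreover have "transpose (- k) = - transpose k" by (simp add: vec_eq_iff transpose_def)
    then have "orthogonal_matrix (- k)"
      using \<open>transpose k ** k = mat 1\<close>
      by (simp add: orthogonal_matrix vec_eq_iff matrix_matrix_mult_def)
    ultimately show ?thesis by (auto simp: Orth_def)
  qed
  then obtain k' where k': "k' \<in> Orth" "embed_SO k' = h \<or> embed_SO k' = - h" by blast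
  have inv: "embed_SO k' ** embed_SO (transpose k') = mat 1"
    using k'(1) by (simp add: Orth_def orthogonal_matrix_def embed_SO_one flip: embed_SO_mult)
  have "embed_SO k' ** g = transpose g ** embed_SO k'"
    using k'(2) h(3) by (auto simp: vec_eq_iff matrix_matrix_mult_def sum_negf)
  then have "embed_SO k' ** g ** embed_SO (transpose k') = transpose g"
    using inv by (simp flip: matrix_mul_assoc)
  then show thesis using that k'(1) by simp
qed

section \<open>Haar integrals and isotypic projections\<close>

lemma linear_complex_functional:
  fixes l :: "complex^'d \<Rightarrow> complex"
  assumes "\<And>x y. l (x + y) = l x + l y" and "\<And>s x. l (s *s x) = s * l x"
  shows "linear l"
  by (rule linearI) (simp_all add: assms scaleR_eq_complex_scale scaleR_conv_of_real)

lemma continuous_on_complex_scale: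
  fixes g :: "'a::topological_space \<Rightarrow> complex^'d"
  assumes "continuous_on S f" and "continuous_on S g"
  shows "continuous_on S (\<lambda>x. f x *s g x)"
  unfolding vector_scalar_mult_def
  by (intro continuous_on_vec_lambda continuous_on_mult assms continuous_on_component)

lemma continuous_on_transpose: "continuous_on S (transpose :: real^'n^'m \<Rightarrow> _)"
  unfolding transpose_def by (intro continuous_on_vec_lambda continuous_intros)

lemma continuous_on_matrix_mult_left: "continuous_on S (\<lambda>k :: real^'n^'n. g ** k)"
  unfolding matrix_matrix_mult_def by (intro continuous_on_vec_lambda continuous_intros)

lemma matrix_inv_orthogonal:
  fixes k :: "real^'n^'n"
  assumes "orthogonal_matrix k"
  shows "matrix_inv k = transpose k"
proof -
  have k: "k ** transpose k = mat 1" "transpose k ** k = mat 1"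
    using assms by (simp_all add: orthogonal_matrix_def)
  then have "k ** matrix_inv k = mat 1 \<and> matrix_inv k ** k = mat 1"
    unfolding matrix_inv_def
    by (intro someI[of "\<lambda>A. k ** A = mat 1 \<and> A ** k = mat 1" "transpose k"]) simp
  then have "(transpose k ** k) ** matrix_inv k = transpose k"
    by (simp flip: matrix_mul_assoc)
  then show ?thesis by (simp add: k)
qed

text \<open>
  \<^const>\<open>vec.representation\<close> is zero outside the span of the basis and hence in general not linear. Coordinates
  with respect to a basis of the whole space that extends \<open>C\<close> are linear functionals, hence continuous.
\<close>

lemma coordinate_functionals_exist:
  fixes C :: "(complex^'d) set"
  assumes C: "vec.independent C"
  obtains l where "\<And>c x y. l c (x + y) = l c x + l c y" and "\<And>c s x. l c (s *s x) = s * l c x"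
    and "\<And>c. c \<in> C \<Longrightarrow> l c c = (1 :: complex)"
    and "\<And>x. x \<in> vec.span C \<Longrightarrow> (\<Sum>c\<in>C. l c x *s c) = x"
    and "\<And>x c. x \<in> vec.span C \<Longrightarrow> vec.representation C x c = l c x"
proof -
  let ?B = "vec.extend_basis C"
  have B: "vec.independent ?B" "vec.span ?B = UNIV" "C \<subseteq> ?B"
    using vec.independent_extend_basis[OF C] vec.span_extend_basis[OF C]
      vec.extend_basis_superset[OF C] by auto
  let ?l = "\<lambda>c x. vec.representation ?B x c"
  have eq: "vec.representation C x c = ?l c x" if "x \<in> vec.span C" for x c
    using vec.representation_extend[OF B(1) that B(3)] by simp
  show thesis
  proof (rule that[of ?l])
    show "?l c (x + y) = ?l c x + ?l c y" for c x y
      using vec.representation_add[OF B(1), of y x] B(2) by simp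
    show "?l c (s *s x) = s * ?l c x" for c s x
      using vec.representation_scale[OF B(1), of x s] B(2) by simp
    show "?l c c = 1" if "c \<in> C" for c
      using vec.representation_basis[OF B(1), of c] B(3) that by auto
    show "(\<Sum>c\<in>C. ?l c x *s c) = x" if "x \<in> vec.span C" for x
      using vec.sum_representation_eq[OF C that vec.finiteI_independent[OF C] order_refl]
      by (simp add: eq[OF that])
    show "vec.representation C x c = ?l c x" if "x \<in> vec.span C" for x c using that by (rule eq)
  qed
qed

text \<open>
  The character of a representation is computed from a basis of an equivalent representation
  inside \<^typ>\<open>complex^'d\<close>: it suffices to move the basis that \<^const>\<open>trace_on\<close> chooses.
\<close>

lemma chi_transport:
  fixes f :: "'v::euclidean_space \<Rightarrow> complex^'d"
  assumes s: "vector_space s" and V: "module.subspace s V" and bij: "bij_betw f V U"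
    and add: "\<And>v w. v \<in> V \<Longrightarrow> w \<in> V \<Longrightarrow> f (v + w) = f v + f w"
    and scale: "\<And>c v. v \<in> V \<Longrightarrow> f (s c v) = c *s f v"
    and \<delta>: "\<And>k v. k \<in> K \<Longrightarrow> v \<in> V \<Longrightarrow> \<delta> k v \<in> V"
      "\<And>k v. k \<in> K \<Longrightarrow> v \<in> V \<Longrightarrow> f (\<delta> k v) = \<rho> k (f v)"
  obtains C where "vec.independent C" and "vec.span C = U"
    and "\<And>k. k \<in> K \<Longrightarrow>
      chi s V \<delta> k = of_nat (card C) * (\<Sum>c\<in>C. vec.representation C (\<rho> k c) c)"
proof -
  interpret s: vector_space s by (rule s)
  interpret p: vector_space_pair s "(*s) :: complex \<Rightarrow> complex^'d \<Rightarrow> _" by unfold_locales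
  define B where "B = (SOME B. \<not> s.dependent B \<and> s.span B = V)"
  obtain B0 where "B0 \<subseteq> V" "s.independent B0" "V \<subseteq> s.span B0"
    using s.maximal_independent_subset by blast
  then have "\<not> s.dependent B0 \<and> s.span B0 = V" using V s.span_minimal by blast
  then have B: "s.independent B" "s.span B = V"
    unfolding B_def by (metis (mono_tags, lifting) someI)+
  have BV: "b \<in> V" if "b \<in> B" for b using that B(2) s.span_base by blast
  obtain F where F: "Vector_Spaces.linear s (*s) F" "\<And>x. x \<in> B \<Longrightarrow> F x = f x"
    using p.linear_independent_extend[OF B(1)] by blast
  interpret F: Vector_Spaces.linear s "(*s)" F by (rule F(1))
  have Ff: "F v = f v" if "v \<in> V" for v
  proof -
    have "v \<in> s.span B \<and> F v = f v"
      using that unfolding B(2)[symmetric]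
    proof (induction rule: s.span_induct_alt)
      case base
      have "f (s 0 0) = 0" using scale[of 0 0] s.subspace_0[OF V] by simp
      then show ?case using s.span_zero by (simp add: F.zero)
    next
      case (step c x y)
      then have "s c x \<in> V" using BV s.subspace_scale[OF V] by blast
      then have "f (s c x + y) = c *s f x + f y" using step B(2) add scale BV by simp
      moreover have "s c x + y \<in> s.span B"
        using step \<open>s c x \<in> V\<close> B(2) s.subspace_add[OF V] by blast
      ultimately show ?case using step F(2) by (simp add: F.add F.scale)
    qed
    then show ?thesis by blast
  qed
  have inj: "inj_on F (s.span B)" using bij Ff unfolding B(2) bij_betw_def inj_on_def by simp
  let ?C = "F ` B"
  have C: "vec.independent ?C" using F.independent_injective_image[OF B(1) inj] .
  have spanC: "vec.span ?C = U"
    using bij Ff B(2) by (simp add: F.span_image bij_betw_def cong: image_cong)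
  have finC: "finite ?C" using C by (rule vec.finiteI_independent)
  have injB: "inj_on F B" using inj s.span_superset inj_on_subset by blast
  have finB: "finite B" using finC injB by (rule finite_imageD)
  have rep: "vec.representation ?C (F x) (F b) = s.representation B x b" if x: "x \<in> V" and b: "b \<in> B" for x b
  proof -
    have mem: "r *s F b' \<in> vec.span ?C" if "b' \<in> B" for b' r
      using that by (intro vec.span_scale vec.span_base) auto
    have "F x = F (\<Sum>b'\<in>B. s (s.representation B x b') b')"
      using s.sum_representation_eq[OF B(1) _ finB order_refl, of x] x B(2) by simp
    also have "\<dots> = (\<Sum>b'\<in>B. s.representation B x b' *s F b')" by (simp add: F.sum F.scale)
    finally have "vec.representation ?C (F x) (F b) =
        (\<Sum>b'\<in>B. vec.representation ?C (s.representation B x b' *s F b') (F b))"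
      by (simp add: vec.representation_sum[OF C mem])
    also have "\<dots> = (\<Sum>b'\<in>B. if b' = b then s.representation B x b' else 0)"
    proof (rule sum.cong[OF refl])
      fix b' assume b': "b' \<in> B"
      have "F b' \<in> vec.span ?C" using b' by (intro vec.span_base) auto
      then show "vec.representation ?C (s.representation B x b' *s F b') (F b) =
          (if b' = b then s.representation B x b' else 0)"
        using b b' injB by (auto simp: vec.representation_scale[OF C] vec.representation_basis[OF C] inj_on_eq_iff)
    qed
    also have "\<dots> = s.representation B x b" using b finB by simp
    finally show ?thesis .
  qed
  have dim: "s.dim V = card ?C"
    using s.dim_eq_card[of B V] B V injB by (simp add: card_image s.span_eq_iff[THEN iffD2])
  have "chi s V \<delta> k = of_nat (card ?C) * (\<Sum>c\<in>?C. vec.representation ?C (\<rho> k c) c)"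
    if k: "k \<in> K" for k
  proof -
    have "(\<Sum>c\<in>?C. vec.representation ?C (\<rho> k c) c) = (\<Sum>b\<in>B. vec.representation ?C (\<rho> k (F b)) (F b))"
      by (simp add: sum.reindex[OF injB])
    also have "\<dots> = (\<Sum>b\<in>B. s.representation B (\<delta> k b) b)"
    proof (rule sum.cong[OF refl])
      fix b assume "b \<in> B"
      then have "\<rho> k (F b) = F (\<delta> k b)" using \<delta>[OF k BV] Ff BV by simp
      then show "vec.representation ?C (\<rho> k (F b)) (F b) = s.representation B (\<delta> k b) b"
        using rep[OF \<delta>(1)[OF k BV]] \<open>b \<in> B\<close> by simp
    qed
    finally show ?thesis unfolding chi_def trace_on_def B_def[symmetric] Let_def by (simp add: dim)
  qed
  then show thesis using that C spanC by blast
qed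

locale compact_group_representation =
  fixes K :: "(real^'n^'n) set" and \<mu> :: "(real^'n^'n) measure"
    and \<rho> :: "real^'n^'n \<Rightarrow> complex^'d \<Rightarrow> complex^'d"
  assumes haar: "normalized_haar K \<mu>" and compact: "compact K"
    and one_mem: "mat 1 \<in> K" and mult_mem: "\<And>k l. k \<in> K \<Longrightarrow> l \<in> K \<Longrightarrow> k ** l \<in> K"
    and transpose_mem: "\<And>k. k \<in> K \<Longrightarrow> transpose k \<in> K"
    and orthogonal: "\<And>k. k \<in> K \<Longrightarrow> orthogonal_matrix k"
    and lin: "\<And>k. k \<in> K \<Longrightarrow> complex_linear (\<rho> k)"
    and hom: "\<And>k l x. k \<in> K \<Longrightarrow> l \<in> K \<Longrightarrow> \<rho> (k ** l) x = \<rho> k (\<rho> l x)"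
    and one: "\<And>x. \<rho> (mat 1) x = x"
    and isometry: "\<And>k x y. k \<in> K \<Longrightarrow> \<rho> k x \<bullet> \<rho> k y = x \<bullet> y"
    and continuous: "\<And>x. continuous_on K (\<lambda>k. \<rho> k x)"
begin

lemma sets_\<mu>: "sets \<mu> = sets (restrict_space borel K)"
  using haar by (simp add: normalized_haar_def)

lemma space_\<mu>: "space \<mu> = K"
  using sets_eq_imp_space_eq[OF sets_\<mu>] by (simp add: space_restrict_space)

lemma measurable_continuous: "continuous_on K f \<Longrightarrow> f \<in> borel_measurable \<mu>"
  using borel_measurable_continuous_on_restrict[of K f] by (simp cong: measurable_cong_sets add: sets_\<mu>)

lemma finite_measure_\<mu>: "finite_measure \<mu>"
  using haar by (intro finite_measureI) (simp add: normalized_haar_def space_\<mu>)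

lemma integral_const: "(LINT k|\<mu>. c) = (c :: 'b::euclidean_space)"
  using haar by (simp add: space_\<mu> measure_def normalized_haar_def)

lemma integrable_continuous:
  fixes f :: "real^'n^'n \<Rightarrow> 'b::euclidean_space"
  assumes "continuous_on K f"
  shows "integrable \<mu> f"
proof -
  have "bounded (f ` K)" using assms compact compact_continuous_image compact_imp_bounded by blast
  then obtain b where "\<And>k. k \<in> K \<Longrightarrow> norm (f k) \<le> b" unfolding bounded_iff by auto
  then show ?thesis
    using measurable_continuous[OF assms]
    by (intro finite_measure.integrable_const_bound[OF finite_measure_\<mu>, of f b]) (auto simp: space_\<mu>)
qed

lemma integral_translate:
  fixes f :: "real^'n^'n \<Rightarrow> 'b::euclidean_space"
  assumes f: "continuous_on K f" and g: "g \<in> K"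
  shows "(LINT k|\<mu>. f (g ** k)) = (LINT k|\<mu>. f k)"
proof -
  have "(\<lambda>k. g ** k) \<in> borel_measurable (restrict_space borel K)"
    by (intro borel_measurable_continuous_on_restrict continuous_on_matrix_mult_left)
  then have "(\<lambda>k. g ** k) \<in> measurable (restrict_space borel K) (restrict_space borel K)"
    using mult_mem[OF g] by (intro measurable_restrict_space2) (auto simp: space_restrict_space)
  then have "(\<lambda>k. g ** k) \<in> measurable \<mu> \<mu>" by (simp cong: measurable_cong_sets add: sets_\<mu>)
  then have "(LINT k|\<mu>. f (g ** k)) = (LINT k|distr \<mu> \<mu> (\<lambda>k. g ** k). f k)"
    using measurable_continuous[OF f] by (simp add: integral_distr)
  also have "distr \<mu> \<mu> (\<lambda>k. g ** k) = \<mu>" using haar g by (simp add: normalized_haar_def)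
  finally show ?thesis .
qed

lemma integral_linear:
  fixes f :: "real^'n^'n \<Rightarrow> 'b::euclidean_space" and T :: "'b \<Rightarrow> 'c::euclidean_space"
  assumes "continuous_on K f" and "linear T"
  shows "(LINT k|\<mu>. T (f k)) = T (LINT k|\<mu>. f k)"
  using integral_bounded_linear[OF _ integrable_continuous[OF assms(1)], of T] assms(2)
  by (simp add: linear_conv_bounded_linear)

lemma integral_cong_K: "(\<And>k. k \<in> K \<Longrightarrow> f k = g k) \<Longrightarrow> (LINT k|\<mu>. f k) = (LINT k|\<mu>. g k)"
  by (intro Bochner_Integration.integral_cong) (auto simp: space_\<mu>)

lemma \<rho>_transpose: "k \<in> K \<Longrightarrow> \<rho> (transpose k) (\<rho> k x) = x" "k \<in> K \<Longrightarrow> \<rho> k (\<rho> (transpose k) x) = x"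
  using orthogonal[of k] transpose_mem[of k] one
  by (simp_all add: orthogonal_matrix_def flip: hom)

lemma \<rho>_adjoint: "k \<in> K \<Longrightarrow> \<rho> k x \<bullet> y = x \<bullet> \<rho> (transpose k) y"
  using isometry[of k x "\<rho> (transpose k) y"] by (simp add: \<rho>_transpose)

text \<open>
  The average over the group of the rank one operator \<open>x \<mapsto> l x *s w\<close> under conjugation. Expanding
  the character in coordinates expresses the isotypic projection through such averages.
\<close>

definition average :: "(complex^'d \<Rightarrow> complex) \<Rightarrow> complex^'d \<Rightarrow> complex^'d \<Rightarrow> complex^'d" where
  "average l w x = (LINT k|\<mu>. l (\<rho> (transpose k) x) *s \<rho> k w)"

context
  fixes l :: "complex^'d \<Rightarrow> complex"
  assumes l_add: "\<And>x y. l (x + y) = l x + l y" and l_scale: "\<And>s x. l (s *s x) = s * l x"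
begin

lemma continuous_on_integrand: "continuous_on K (\<lambda>k. l (\<rho> (transpose k) x) *s \<rho> k w)"
proof -
  have "continuous_on K (\<lambda>k. \<rho> (transpose k) x)"
    using transpose_mem
    by (intro continuous_on_compose2[OF continuous continuous_on_transpose]) auto
  moreover have "bounded_linear l"
    using linear_complex_functional[OF l_add l_scale] by (simp add: linear_conv_bounded_linear)
  ultimately have "continuous_on K (\<lambda>k. l (\<rho> (transpose k) x))"
    using continuous_on_compose2[OF linear_continuous_on[of l UNIV]] by blast
  then show ?thesis by (rule continuous_on_complex_scale[OF _ continuous])
qed

lemma complex_linear_average: "complex_linear (average l w)"
proof (rule complex_linearI)
  note c = continuous_on_integrand and tm = transpose_mem
  show "average l w (x + y) = average l w x + average l w y" for x y
  proof -
    have "average l w (x + y) =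
        (LINT k|\<mu>. l (\<rho> (transpose k) x) *s \<rho> k w + l (\<rho> (transpose k) y) *s \<rho> k w)"
      unfolding average_def
      by (rule integral_cong_K) (simp add: complex_linearD[OF lin[OF tm]] l_add vec.scale_left_distrib)
    then show ?thesis
      unfolding average_def by (simp add: Bochner_Integration.integral_add integrable_continuous c)
  qed
  show "average l w (s *s x) = s *s average l w x" for s x
  proof -
    have "average l w (s *s x) = (LINT k|\<mu>. s *s (l (\<rho> (transpose k) x) *s \<rho> k w))"
      unfolding average_def
      by (rule integral_cong_K) (simp add: complex_linearD[OF lin[OF tm]] l_scale)
    also have "\<dots> = s *s average l w x"
      unfolding average_def
      by (rule integral_linear[OF c]) (intro complex_linear_imp_linear complex_linearI,
        simp_all add: vec.scale_right_distrib mult.commute)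
    finally show ?thesis .
  qed
qed

lemma average_equivariant:
  assumes g: "g \<in> K"
  shows "average l w (\<rho> g x) = \<rho> g (average l w x)"
proof -
  let ?f = "\<lambda>k. l (\<rho> (transpose k) (\<rho> g x)) *s \<rho> k w"
  have "average l w (\<rho> g x) = (LINT k|\<mu>. ?f (g ** k))"
    unfolding average_def by (rule integral_translate[OF continuous_on_integrand g, symmetric])
  also have "\<dots> = (LINT k|\<mu>. \<rho> g (l (\<rho> (transpose k) x) *s \<rho> k w))"
  proof (rule integral_cong_K)
    fix k assume k: "k \<in> K"
    then show "?f (g ** k) = \<rho> g (l (\<rho> (transpose k) x) *s \<rho> k w)"
      using g transpose_mem
      by (simp add: matrix_transpose_mul hom \<rho>_transpose complex_linearD[OF lin])
  qed
  also have "\<dots> = \<rho> g (average l w x)"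
    unfolding average_def
    by (intro integral_linear continuous_on_integrand complex_linear_imp_linear lin g)
  finally show ?thesis .
qed

lemma average_orthogonal:
  assumes "\<And>k u. k \<in> K \<Longrightarrow> u \<in> U \<Longrightarrow> \<rho> k u \<in> U" and "vec.subspace U"
    and w: "\<And>u. u \<in> U \<Longrightarrow> w \<bullet> u = 0" and "u \<in> U"
  shows "average l w x \<bullet> u = 0"
proof -
  have "(l (\<rho> (transpose k) x) *s \<rho> k w) \<bullet> u = 0" if k: "k \<in> K" for k
  proof -
    have "cnj (l (\<rho> (transpose k) x)) *s u \<in> U" using assms vec.subspace_scale by blast
    then show ?thesis
      using w assms(1)[OF transpose_mem[OF k]] by (simp add: inner_complex_scale \<rho>_adjoint[OF k])
  qed
  then have "(LINT k|\<mu>. (l (\<rho> (transpose k) x) *s \<rho> k w) \<bullet> u) = (LINT k|\<mu>. 0)"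
    by (intro integral_cong_K) auto
  moreover have "(LINT k|\<mu>. (l (\<rho> (transpose k) x) *s \<rho> k w) \<bullet> u) = average l w x \<bullet> u"
    unfolding average_def
    by (rule integral_linear[OF continuous_on_integrand]) (simp add: linearI inner_add_left)
  ultimately show ?thesis by simp
qed

end

text \<open>
  Let \<open>l c\<close> be the coordinates with respect to a basis \<open>C\<close> of \<open>U\<close>, and let \<open>?A c w\<close> be the average of
  \<open>x \<mapsto> l c x *s w\<close>. Inserting the formula for the character gives
  \<open>?P w = card C *s (\<Sum>c\<in>C. ?A c w c)\<close>. The averages are equivariant, so by \<open>mult_one\<close> they map \<open>U\<close>
  into \<open>U\<close>. If \<open>w\<close> is orthogonal to \<open>U\<close>, their values on \<open>U\<close> are also orthogonal to \<open>U\<close> and hence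
  zero. If \<open>w\<close> lies in \<open>U\<close>, Schur's lemma makes \<open>?A c w\<close> a scalar on \<open>U\<close>; comparing traces, the
  scalar is \<open>l c w\<close> divided by \<open>card C\<close>, and the sum returns \<open>w\<close>.
\<close>

lemma character_projection:
  assumes irr: "irreducible_under (\<rho> ` K) U"
    and inv: "\<And>k u. k \<in> K \<Longrightarrow> u \<in> U \<Longrightarrow> \<rho> k u \<in> U"
    and mult_one: "\<And>A u. complex_linear A \<Longrightarrow> (\<And>k x. k \<in> K \<Longrightarrow> A (\<rho> k x) = \<rho> k (A x)) \<Longrightarrow>
        u \<in> U \<Longrightarrow> A u \<in> U"
    and C: "vec.independent C" "vec.span C = U"
    and ch: "\<And>k. k \<in> K \<Longrightarrow>
        ch k = of_nat (card C) * (\<Sum>c\<in>C. vec.representation C (\<rho> k c) c)"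
  shows "(LINT k|\<mu>. ch (matrix_inv k) *s \<rho> k w) = orth_proj U w"
proof -
  have U: "vec.subspace U" using C(2) by auto
  have CU: "c \<in> U" if "c \<in> C" for c using that C(2) vec.span_base by blast
  obtain l where l: "\<And>c x y. l c (x + y) = l c x + l c y" "\<And>c s x. l c (s *s x) = s * l c x"
    "\<And>c. c \<in> C \<Longrightarrow> l c c = (1 :: complex)"
    "\<And>x. x \<in> vec.span C \<Longrightarrow> (\<Sum>c\<in>C. l c x *s c) = x"
    "\<And>x c. x \<in> vec.span C \<Longrightarrow> vec.representation C x c = l c x"
    using coordinate_functionals_exist[OF C(1)] by blast
  have l0: "l c 0 = 0" for c using l(2)[of c 0 0] by simp
  have l_sum: "l c (sum h S) = (\<Sum>i\<in>S. l c (h i))" for c S and h :: "complex^'d \<Rightarrow> complex^'d"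
    by (induction S rule: infinite_finite_induct) (simp_all add: l(1) l0)
  let ?A = "\<lambda>c. average (l c)"
  let ?P = "\<lambda>w. LINT k|\<mu>. ch (matrix_inv k) *s \<rho> k w"
  note lin_A = complex_linear_average[OF l(1,2)]
  have P: "?P w = of_nat (card C) *s (\<Sum>c\<in>C. ?A c w c)" for w
  proof -
    have "?P w = (LINT k|\<mu>. of_nat (card C) *s (\<Sum>c\<in>C. l c (\<rho> (transpose k) c) *s \<rho> k w))"
    proof (rule integral_cong_K)
      fix k assume k: "k \<in> K"
      have "ch (matrix_inv k) = of_nat (card C) * (\<Sum>c\<in>C. l c (\<rho> (transpose k) c))"
        using ch[OF transpose_mem[OF k]] inv[OF transpose_mem[OF k] CU] C(2) l(5)
        by (simp add: matrix_inv_orthogonal[OF orthogonal[OF k]])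
      then show "ch (matrix_inv k) *s \<rho> k w =
          of_nat (card C) *s (\<Sum>c\<in>C. l c (\<rho> (transpose k) c) *s \<rho> k w)"
        by (simp only: vec.scale_scale[symmetric] vec.scale_sum_left)
    qed
    also have "\<dots> = of_nat (card C) *s (LINT k|\<mu>. (\<Sum>c\<in>C. l c (\<rho> (transpose k) c) *s \<rho> k w))"
      by (rule integral_linear)
        (intro continuous_on_sum continuous_on_integrand l, intro complex_linear_imp_linear complex_linearI,
          simp_all add: vec.scale_right_distrib mult.commute)
    also have "(LINT k|\<mu>. (\<Sum>c\<in>C. l c (\<rho> (transpose k) c) *s \<rho> k w)) = (\<Sum>c\<in>C. ?A c w c)"
      unfolding average_def
      by (rule Bochner_Integration.integral_sum) (intro integrable_continuous continuous_on_integrand l)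
    finally show ?thesis .
  qed
  have A_mem: "?A c w u \<in> U" if "u \<in> U" for c w u
    using lin_A average_equivariant[OF l(1,2)] that by (rule mult_one)
  have kernel: "?P w = 0" if w: "\<And>u. u \<in> U \<Longrightarrow> w \<bullet> u = 0" for w
  proof -
    have "?A c w c = 0" if "c \<in> C" for c
    proof -
      have "?A c w c \<bullet> ?A c w c = 0"
        by (rule average_orthogonal[OF l(1,2) inv U w A_mem[OF CU[OF that]]])
      then show ?thesis by simp
    qed
    then show ?thesis unfolding P by simp
  qed
  have fixed: "?P w = w" if w: "w \<in> U" for w
  proof -
    have trace: "of_nat (card C) * \<alpha> = l c w" if "\<And>u. u \<in> U \<Longrightarrow> ?A c w u = \<alpha> *s u" for c \<alpha>
    proof -
      have "of_nat (card C) * \<alpha> = (\<Sum>c'\<in>C. l c' (?A c w c'))"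
        using that CU by (simp add: l(2,3))
      also have "\<dots> = (\<Sum>c'\<in>C. LINT k|\<mu>. l c' (l c (\<rho> (transpose k) c') *s \<rho> k w))"
        unfolding average_def
        by (intro sum.cong refl integral_linear[symmetric] continuous_on_integrand
            linear_complex_functional l)
      also have "\<dots> = (LINT k|\<mu>. (\<Sum>c'\<in>C. l c' (l c (\<rho> (transpose k) c') *s \<rho> k w)))"
        by (intro Bochner_Integration.integral_sum[symmetric] integrable_continuous
            continuous_on_compose2[OF linear_continuous_on continuous_on_integrand]
            linear_complex_functional[unfolded linear_conv_bounded_linear] l) auto
      also have "\<dots> = (LINT k|\<mu>. l c w)"
      proof (rule integral_cong_K)
        fix k assume k: "k \<in> K"
        have "(\<Sum>c'\<in>C. l c' (l c (\<rho> (transpose k) c') *s \<rho> k w)) =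
            l c (\<rho> (transpose k) (\<Sum>c'\<in>C. l c' (\<rho> k w) *s c'))"
          by (simp add: l(2) l_sum complex_linearD[OF lin[OF transpose_mem[OF k]]] mult.commute)
        also have "(\<Sum>c'\<in>C. l c' (\<rho> k w) *s c') = \<rho> k w"
          using inv[OF k w] C(2) by (intro l(4)) simp
        finally show "(\<Sum>c'\<in>C. l c' (l c (\<rho> (transpose k) c') *s \<rho> k w)) = l c w"
          by (simp add: \<rho>_transpose[OF k])
      qed
      finally show ?thesis by (simp only: integral_const)
    qed
    have "of_nat (card C) *s ?A c w c = l c w *s c" if "c \<in> C" for c
    proof -
      obtain \<alpha> where \<alpha>: "\<And>u. u \<in> U \<Longrightarrow> ?A c w u = \<alpha> *s u"
      proof (rule schur_scalar[OF irr _ _ lin_A])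
        show "complex_linear s" if "s \<in> \<rho> ` K" for s using that lin by auto
        show "s x \<in> U" if "s \<in> \<rho> ` K" "x \<in> U" for s x using that inv by auto
        show "?A c w (s x) = s (?A c w x)" if "s \<in> \<rho> ` K" for s x
          using that by (auto simp: average_equivariant[of "l c", OF l(1,2)])
      qed (use A_mem in auto)
      then show ?thesis using trace[OF \<alpha>] CU[OF that] by simp
    qed
    then have "?P w = (\<Sum>c\<in>C. l c w *s c)" unfolding P by (simp add: vec.scale_sum_right)
    then show ?thesis using l(4) w C(2) by simp
  qed
  have S: "subspace U" using U by (rule complex_subspace_imp_subspace)
  let ?u = "orth_proj U w"
  have P_add: "?P (x + y) = ?P x + ?P y" for x y
  proof -
    have "?A c (x + y) c = ?A c x c + ?A c y c" for c
    proof -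
      have "?A c (x + y) c =
          (LINT k|\<mu>. l c (\<rho> (transpose k) c) *s \<rho> k x + l c (\<rho> (transpose k) c) *s \<rho> k y)"
        unfolding average_def
        by (rule integral_cong_K) (simp add: complex_linearD[OF lin] vec.scale_right_distrib)
      then show ?thesis
        unfolding average_def
        by (simp add: Bochner_Integration.integral_add integrable_continuous continuous_on_integrand l)
    qed
    then show ?thesis unfolding P by (simp add: sum.distrib vec.scale_right_distrib)
  qed
  have "?P w = ?P (?u + (w - ?u))" by simp
  also have "\<dots> = ?u"
    using orth_proj[OF S] unfolding P_add by (subst fixed, simp, subst kernel, simp_all)
  finally show ?thesis .
qed

end

section \<open>Compactness and cosets of the orthogonal groups\<close>

lemma SO_subset_Orth: "SO \<subseteq> Orth"
  by (auto simp: SO_def Orth_def rotation_matrix_def)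

lemma Orth_closed:
  "mat 1 \<in> Orth" "k \<in> Orth \<Longrightarrow> l \<in> Orth \<Longrightarrow> k ** l \<in> Orth" "k \<in> Orth \<Longrightarrow> transpose k \<in> Orth"
  by (auto simp: Orth_def orthogonal_matrix_id orthogonal_matrix_mul)

lemma SO_closed:
  "mat 1 \<in> SO" "k \<in> SO \<Longrightarrow> l \<in> SO \<Longrightarrow> k ** l \<in> SO" "k \<in> SO \<Longrightarrow> transpose k \<in> SO"
  by (auto simp: SO_def rotation_matrix_def orthogonal_matrix_id orthogonal_matrix_mul det_mul)

lemma compact_Orth: "compact (Orth :: (real^'n^'n) set)"
proof (rule compact_eq_bounded_closed[THEN iffD2, OF conjI])
  show "bounded (Orth :: (real^'n^'n) set)"
  proof (rule boundedI)
    fix A :: "real^'n^'n" assume "A \<in> Orth"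
    then have "norm (A $ i) = 1" for i
      using orthogonal_matrix_orthonormal_rows[of A] by (simp add: Orth_def row_def vec_lambda_eta)
    then have "A $ i \<bullet> A $ i = 1" for i by (simp add: dot_square_norm)
    then have "A \<bullet> A = real CARD('n)" by (simp add: inner_vec_def[of A A])
    then show "norm A \<le> sqrt (real CARD('n))" by (simp add: norm_eq_sqrt_inner)
  qed
  have "continuous_on UNIV (\<lambda>A :: real^'n^'n. transpose A ** A)"
    unfolding matrix_matrix_mult_def transpose_def
    by (intro continuous_on_vec_lambda continuous_intros)
  then have "closed {A :: real^'n^'n. transpose A ** A = mat 1}"
    by (intro closed_Collect_eq continuous_on_const)
  then show "closed (Orth :: (real^'n^'n) set)" by (simp add: Orth_def orthogonal_matrix)
qed

lemma compact_SO: "compact (SO :: (real^'n^'n) set)"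
proof -
  have "closed {A :: real^'n^'n. det A = 1}"
    by (intro closed_Collect_eq continuous_on_const continuous_on_det)
  then have "compact (Orth \<inter> {A :: real^'n^'n. det A = 1})"
    by (rule compact_Int_closed[OF compact_Orth])
  moreover have "Orth \<inter> {A :: real^'n^'n. det A = 1} = SO"
    by (auto simp: SO_def Orth_def rotation_matrix_def)
  ultimately show ?thesis by metis
qed

lemma transpose_reflection: "transpose (reflection l) = reflection l"
  by (auto simp: reflection_def transpose_def vec_eq_iff)

lemma reflection_involution: "reflection l ** reflection l = mat 1"
proof -
  have "(\<Sum>k\<in>UNIV. reflection l $ i $ k * reflection l $ k $ j) =
      (\<Sum>k\<in>UNIV. if k = i then mat 1 $ i $ j else 0)" for i j
    by (rule sum.cong) (auto simp: reflection_def mat_def)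
  then show ?thesis by (simp add: matrix_matrix_mult_def vec_eq_iff)
qed

lemma reflection_in_Orth: "reflection l \<in> Orth"
  by (simp add: Orth_def orthogonal_matrix_def transpose_reflection reflection_involution)

lemma det_reflection: "det (reflection l) = - 1"
proof -
  have "det (reflection l) = (\<Prod>i\<in>UNIV. reflection l $ i $ i)"
    by (rule det_diagonal) (simp add: reflection_def)
  also have "\<dots> = - 1" by (simp add: reflection_def prod.delta)
  finally show ?thesis .
qed

lemma Orth_cases:
  assumes "k \<in> Orth"
  obtains "k \<in> SO" | k' where "k' \<in> SO" and "k = k' ** reflection l"
proof (cases "det k = 1")
  case True
  then show ?thesis using assms that(1) by (simp add: SO_def Orth_def rotation_matrix_def)
next
  case False
  then have "det k = - 1" using assms det_orthogonal_matrix by (auto simp: Orth_def)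
  then have "k ** reflection l \<in> SO"
    using Orth_closed(2)[OF assms reflection_in_Orth[of l]]
    by (simp add: SO_def Orth_def rotation_matrix_def det_mul det_reflection)
  moreover have "k = k ** reflection l ** reflection l"
    by (simp add: reflection_involution flip: matrix_mul_assoc)
  ultimately show ?thesis using that(2) by blast
qed

lemma conj_reflection_in_SO:
  assumes "k \<in> SO"
  shows "reflection l ** k ** reflection l \<in> SO"
proof -
  have "k \<in> Orth" using assms SO_subset_Orth by blast
  then have "reflection l ** k ** reflection l \<in> Orth"
    by (intro Orth_closed(2) reflection_in_Orth)
  then show ?thesis
    using assms by (simp add: SO_def Orth_def rotation_matrix_def det_mul det_reflection)
qed

section \<open>Transport of representations along linear bijections\<close>

text \<open>
  Continuity of the transported action uses a real linear left inverse of \<open>\<iota>\<close> on the ambient spaces,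
  which is continuous by finite dimensionality.
\<close>

lemma irreducible_representation_transport:
  fixes s :: "complex \<Rightarrow> 'w \<Rightarrow> 'w::euclidean_space" and \<iota> :: "'w \<Rightarrow> complex^'d"
  assumes irr: "irreducible_representation K (*s) U \<rho>"
    and s: "\<And>r x. s (of_real r) x = r *\<^sub>R x" and \<iota>: "Vector_Spaces.linear s (*s) \<iota>"
    and X: "module.subspace s X" and bij: "bij_betw \<iota> X U"
    and \<gamma>: "\<And>k x. k \<in> K \<Longrightarrow> x \<in> X \<Longrightarrow> \<gamma> k x \<in> X"
      "\<And>k x. k \<in> K \<Longrightarrow> x \<in> X \<Longrightarrow> \<iota> (\<gamma> k x) = \<rho> k (\<iota> x)"
    and K: "mat 1 \<in> K" "\<And>k l. k \<in> K \<Longrightarrow> l \<in> K \<Longrightarrow> k ** l \<in> K"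
  shows "irreducible_representation K s X \<gamma>"
    and "equivalent_representations K (*s) U \<rho> s X \<gamma>"
proof -
  interpret \<iota>: Vector_Spaces.linear s "(*s)" \<iota> by (rule \<iota>)
  note sub = \<iota>.vs1.subspace_def[THEN iffD1, OF X]
  have U: "\<iota> x \<in> U" if "x \<in> X" for x using that bij by (auto simp: bij_betw_def)
  have eqI: "x = y" if "x \<in> X" "y \<in> X" "\<iota> x = \<iota> y" for x y
    using that bij by (auto simp: bij_betw_def inj_on_def)
  have rep: "matrix_group_rep K (*s) U \<rho>" and U0: "U \<noteq> {0}"
    and min: "\<And>W. vec.subspace W \<Longrightarrow> W \<subseteq> U \<Longrightarrow> (\<forall>k\<in>K. \<forall>w\<in>W. \<rho> k w \<in> W) \<Longrightarrow> W = {0} \<or> W = U"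
    using irr unfolding irreducible_representation_def by auto
  note r = rep[unfolded matrix_group_rep_def]
  have "linear \<iota>"
  proof (rule linearI)
    show "\<iota> (r *\<^sub>R x) = r *\<^sub>R \<iota> x" for r x
      using \<iota>.scale[of "of_real r" x] by (simp add: s scaleR_eq_complex_scale)
  qed (rule \<iota>.add)
  moreover have "subspace X"
    using sub unfolding subspace_def by (auto simp flip: s)
  ultimately obtain g where g: "linear g" "\<And>x. x \<in> X \<Longrightarrow> g (\<iota> x) = x"
    using linear_exists_left_inverse_on[of \<iota> X] bij by (auto simp: bij_betw_def)
  have "matrix_group_rep K s X \<gamma>"
    unfolding matrix_group_rep_def
  proof (intro conjI ballI allI)
    fix k v assume k: "k \<in> K" and v: "v \<in> X"
    show "\<gamma> k v \<in> X" using k v by (rule \<gamma>)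
    show "\<gamma> k (s c v) = s c (\<gamma> k v)" for c
      using k v sub \<gamma> r U by (intro eqI) (auto simp: \<iota>.scale)
    show "\<gamma> k (v + w) = \<gamma> k v + \<gamma> k w" if "w \<in> X" for w
      using k v that sub \<gamma> r U by (intro eqI) (auto simp: \<iota>.add)
    show "\<gamma> (k ** l) v = \<gamma> k (\<gamma> l v)" if "l \<in> K" for l
      using k v that \<gamma> r U K by (intro eqI) auto
  next
    fix v assume v: "v \<in> X"
    show "\<gamma> (mat 1) v = v" using v \<gamma> r U K by (intro eqI) auto
    have "continuous_on K (\<lambda>k. \<rho> k (\<iota> v))" using r U[OF v] by blast
    then have "continuous_on K (\<lambda>k. g (\<rho> k (\<iota> v)))"
      using linear_continuous_on[of g UNIV] g(1) continuous_on_compose2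
      by (metis linear_conv_bounded_linear top_greatest)
    moreover have "g (\<rho> k (\<iota> v)) = \<gamma> k v" if "k \<in> K" for k
      using g(2)[OF \<gamma>(1)[OF that v]] by (simp only: \<gamma>(2)[OF that v])
    ultimately show "continuous_on K (\<lambda>k. \<gamma> k v)" by (simp cong: continuous_on_cong)
  qed (rule X)
  moreover have "X \<noteq> {0}" using U0 bij \<iota>.zero by (auto simp: bij_betw_def)
  moreover have "W = {0} \<or> W = X"
    if W: "\<iota>.vs1.subspace W \<and> W \<subseteq> X \<and> (\<forall>k\<in>K. \<forall>w\<in>W. \<gamma> k w \<in> W)" for W
  proof -
    have "\<rho> k (\<iota> w) \<in> \<iota> ` W" if "k \<in> K" "w \<in> W" for k w
      using \<gamma>(2)[OF that(1), of w] that W by (metis imageI subsetD)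
    then have "\<iota> ` W = {0} \<or> \<iota> ` W = U"
      using W U by (intro min \<iota>.subspace_image) auto
    moreover have "0 \<in> W" using W \<iota>.vs1.subspace_0 by blast
    then have "W = {0}" if "\<iota> ` W = {0}"
    proof -
      have "w = 0" if "w \<in> W" for w
      proof (rule eqI)
        show "w \<in> X" "0 \<in> X" using that \<open>0 \<in> W\<close> W by blast+
        show "\<iota> w = \<iota> 0" using \<open>\<iota> ` W = {0}\<close> that by (auto simp: \<iota>.zero)
      qed
      then show ?thesis using \<open>0 \<in> W\<close> by blast
    qed
    moreover have "W = X" if "\<iota> ` W = U"
      using that W bij by (metis bij_betw_def inj_on_image_eq_iff order_refl)
    ultimately show ?thesis by blast
  qed
  ultimately show "irreducible_representation K s X \<gamma>"
    unfolding irreducible_representation_def by blast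
  let ?J = "inv_into X \<iota>"
  have J: "?J u \<in> X" "\<iota> (?J u) = u" if "u \<in> U" for u
    using that bij by (auto simp: bij_betw_def inv_into_into f_inv_into_f)
  show "equivalent_representations K (*s) U \<rho> s X \<gamma>"
    unfolding equivalent_representations_def
  proof (intro exI[of _ ?J] conjI ballI allI)
    show "bij_betw ?J U X" using bij by (rule bij_betw_inv_into)
    fix v assume v: "v \<in> U"
    show "?J (v + w) = ?J v + ?J w" if "w \<in> U" for w
      using v that J sub r by (intro eqI) (auto simp: \<iota>.add vec.subspace_add)
    show "?J (c *s v) = s c (?J v)" for c
      using v J sub r by (intro eqI) (auto simp: \<iota>.scale vec.subspace_scale)
    show "?J (\<rho> k v) = \<gamma> k (?J v)" if "k \<in> K" for k
      using v that J r \<gamma> by (intro eqI) auto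
  qed
qed

section \<open>The reflected subrepresentation\<close>

locale reflected_subrepresentation =
  fixes \<tau> :: "real^('n::finite option)^('n option) \<Rightarrow> complex^'d \<Rightarrow> complex^'d"
    and V :: "(complex^'d) set"
    and \<pi> \<pi>\<^sub>\<phi> :: "real^'n^'n \<Rightarrow> complex^'d \<Rightarrow> complex^'d"
    and l :: 'n
    and a :: "real^'n^'n"
  assumes n_even: "even CARD('n)"
    and a_eq: "a = reflection l"
    and \<tau>_irreducible: "irreducible_representation SO (*s) UNIV \<tau>"
    and \<tau>_unitary: "unitary_on SO UNIV \<tau>"
    and \<pi>_irreducible: "irreducible_representation SO (*s) V \<pi>"
    and \<pi>_subrepresentation: "\<forall>k\<in>SO. \<forall>v\<in>V. \<pi> k v = \<tau> (embed_SO k) v"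
    and \<pi>\<^sub>\<phi>_eq: "\<pi>\<^sub>\<phi> = (\<lambda>k. \<pi> (a ** k ** a))"
    and \<pi>_not_equivalent: "\<not> equivalent_representations SO (*s) V \<pi> (*s) V \<pi>\<^sub>\<phi>"
begin

abbreviation \<rho> :: "real^'n^'n \<Rightarrow> complex^'d \<Rightarrow> complex^'d" where
  "\<rho> k \<equiv> \<tau> (embed_SO k)"

abbreviation T :: "complex^'d \<Rightarrow> complex^'d" where
  "T \<equiv> \<rho> a"

lemma a_Orth: "a \<in> Orth" and a_a: "a ** a = mat 1" and a_SO: "k \<in> SO \<Longrightarrow> a ** k ** a \<in> SO"
  unfolding a_eq by (simp_all add: reflection_in_Orth reflection_involution conj_reflection_in_SO)

lemma a_cancel: "k ** a ** a = k" "a ** (a ** k) = k"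
  by (simp_all add: a_a flip: matrix_mul_assoc) (simp add: a_a matrix_mul_assoc)

lemma a_conj_twice: "a ** (a ** k ** a) ** a = k"
  by (simp only: matrix_mul_assoc a_a) (simp add: a_cancel)

lemma \<tau>_rep:
  "g \<in> SO \<Longrightarrow> complex_linear (\<tau> g)" "g \<in> SO \<Longrightarrow> h \<in> SO \<Longrightarrow> \<tau> (g ** h) x = \<tau> g (\<tau> h x)"
  "\<tau> (mat 1) x = x" "g \<in> SO \<Longrightarrow> \<tau> g x \<bullet> \<tau> g y = x \<bullet> y" "continuous_on SO (\<lambda>g. \<tau> g x)"
  using \<tau>_irreducible \<tau>_unitary
  by (auto simp: irreducible_representation_def matrix_group_rep_def unitary_on_def
      inner_complex_vec_eq_Re_herm intro: complex_linearI)

lemma \<rho>_lin: "k \<in> Orth \<Longrightarrow> complex_linear (\<rho> k)"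
  by (simp add: \<tau>_rep embed_SO_in_SO)

lemma \<rho>_hom: "k \<in> Orth \<Longrightarrow> k' \<in> Orth \<Longrightarrow> \<rho> (k ** k') x = \<rho> k (\<rho> k' x)"
  by (simp add: \<tau>_rep embed_SO_in_SO embed_SO_mult)

lemma \<rho>_one: "\<rho> (mat 1) x = x"
  by (simp add: \<tau>_rep embed_SO_one)

lemma \<rho>_isometry: "k \<in> Orth \<Longrightarrow> \<rho> k x \<bullet> \<rho> k y = x \<bullet> y"
  by (simp add: \<tau>_rep embed_SO_in_SO)

lemma \<rho>_continuous: "continuous_on Orth (\<lambda>k. \<rho> k x)"
  using embed_SO_in_SO
  by (intro continuous_on_compose2[OF \<tau>_rep(5) continuous_on_embed_SO]) auto

lemma \<rho>_transpose: "k \<in> Orth \<Longrightarrow> \<rho> (transpose k) (\<rho> k x) = x" "k \<in> Orth \<Longrightarrow> \<rho> k (\<rho> (transpose k) x) = x"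
proof -
  assume k: "k \<in> Orth"
  then have "transpose k ** k = mat 1" by (simp add: Orth_def orthogonal_matrix_def)
  with k Orth_closed(3)[OF k] show "\<rho> (transpose k) (\<rho> k x) = x"
    by (simp add: \<rho>_one flip: \<rho>_hom)
next
  assume k: "k \<in> Orth"
  then have "k ** transpose k = mat 1" by (simp add: Orth_def orthogonal_matrix_def)
  with k Orth_closed(3)[OF k] show "\<rho> k (\<rho> (transpose k) x) = x"
    by (simp add: \<rho>_one flip: \<rho>_hom)
qed

lemma \<rho>_adjoint: "k \<in> Orth \<Longrightarrow> \<rho> k x \<bullet> y = x \<bullet> \<rho> (transpose k) y"
  using \<rho>_isometry[of k x "\<rho> (transpose k) y"] by (simp add: \<rho>_transpose)

lemma V_subspace: "vec.subspace V" and V_nonzero: "V \<noteq> {0}"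
  using \<pi>_irreducible by (auto simp: irreducible_representation_def matrix_group_rep_def)

lemma \<pi>_eq: "k \<in> SO \<Longrightarrow> v \<in> V \<Longrightarrow> \<pi> k v = \<rho> k v"
  using \<pi>_subrepresentation by blast

lemma \<rho>_V: "k \<in> SO \<Longrightarrow> v \<in> V \<Longrightarrow> \<rho> k v \<in> V"
  using \<pi>_irreducible \<pi>_eq by (fastforce simp: irreducible_representation_def matrix_group_rep_def)

lemma \<pi>\<^sub>\<phi>_rho: "k \<in> SO \<Longrightarrow> v \<in> V \<Longrightarrow> \<pi>\<^sub>\<phi> k v = \<rho> (a ** k ** a) v"
  by (simp add: \<pi>\<^sub>\<phi>_eq \<pi>_eq a_SO)

lemma irreducible_V: "irreducible_under (\<rho> ` SO) V"
  using \<pi>_irreducible \<pi>_eq V_subspace V_nonzero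
  unfolding irreducible_under_def irreducible_representation_def
  by (metis (no_types, lifting) image_eqI subsetD)

lemma SO_Orth: "k \<in> SO \<Longrightarrow> k \<in> Orth"
  using SO_subset_Orth by blast

lemma T_T [simp]: "T (T x) = x"
  using \<rho>_hom[OF a_Orth a_Orth] by (simp add: a_a \<rho>_one)

lemma \<rho>_T: "k \<in> SO \<Longrightarrow> \<rho> k (T x) = T (\<rho> (a ** k ** a) x)"
proof -
  assume k: "k \<in> SO"
  have "a ** (a ** k ** a) = k ** a" by (simp only: matrix_mul_assoc a_a matrix_mul_lid)
  then show ?thesis
    using \<rho>_hom[OF a_Orth SO_Orth[OF a_SO[OF k]], of x] \<rho>_hom[OF SO_Orth[OF k] a_Orth, of x] by simp
qed

lemma T_\<rho>: "k \<in> SO \<Longrightarrow> T (\<rho> k x) = \<rho> (a ** k ** a) (T x)"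
proof -
  assume k: "k \<in> SO"
  show ?thesis using \<rho>_T[OF a_SO[OF k], of x] by (simp only: a_conj_twice)
qed

lemmas T_linear = complex_linearD[OF \<rho>_lin[OF a_Orth]]

text \<open>
  A nonzero operator on \<open>V\<close> that intertwines \<open>\<pi>\<close> with \<open>\<pi>\<^sub>\<phi>\<close> would be an equivalence. The reflected
  action is irreducible because conjugation by \<open>a\<close> permutes SO(n).
\<close>

lemma no_reflected_intertwiner:
  assumes A: "complex_linear A" "\<And>v. v \<in> V \<Longrightarrow> A v \<in> V"
    and comm: "\<And>k v. k \<in> SO \<Longrightarrow> v \<in> V \<Longrightarrow> A (\<rho> k v) = \<rho> (a ** k ** a) (A v)"
    and v: "v \<in> V"
  shows "A v = 0"
proof -
  have "(\<lambda>k. \<rho> (a ** k ** a)) ` SO = \<rho> ` SO"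
  proof -
    have "(\<lambda>k. a ** k ** a) ` SO = SO"
    proof
      show "(\<lambda>k. a ** k ** a) ` SO \<subseteq> SO" using a_SO by blast
      show "SO \<subseteq> (\<lambda>k. a ** k ** a) ` SO"
      proof
        fix k :: "real^'n^'n" assume "k \<in> SO"
        then show "k \<in> (\<lambda>k. a ** k ** a) ` SO"
          using a_SO by (intro image_eqI[of _ _ "a ** k ** a"]) (simp_all only: a_conj_twice)
      qed
    qed
    then show ?thesis by (metis image_image)
  qed
  then have "irreducible_under ((\<lambda>k. \<rho> (a ** k ** a)) ` SO) V" using irreducible_V by simp
  then have "(\<forall>x\<in>V. A x = 0) \<or> bij_betw A V V"
    using A comm \<rho>_V complex_linearD(3)[OF \<rho>_lin[OF SO_Orth[OF a_SO]]]
    by (intro schur_zero_or_bijective[OF irreducible_V]) auto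
  moreover have "\<not> bij_betw A V V"
  proof
    assume "bij_betw A V V"
    then have "equivalent_representations SO (*s) V \<pi> (*s) V \<pi>\<^sub>\<phi>"
      unfolding equivalent_representations_def
      using A(2) comm by (intro exI[of _ A]) (simp add: complex_linearD[OF A(1)] \<pi>_eq \<pi>\<^sub>\<phi>_rho)
    then show False using \<pi>_not_equivalent by blast
  qed
  ultimately show ?thesis using v by blast
qed

lemma orth_proj_equivariant:
  assumes "vec.subspace W" and "k \<in> Orth" and "\<And>w. w \<in> W \<Longrightarrow> \<rho> k w \<in> W"
    and "\<And>w. w \<in> W \<Longrightarrow> \<rho> (transpose k) w \<in> W"
  shows "orth_proj W (\<rho> k x) = \<rho> k (orth_proj W x)"
  using assms Orth_closed(3)[OF assms(2)]
  by (intro orth_proj_commute[where S' = "\<rho> (transpose k)"] complex_subspace_imp_subspace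
      complex_linear_imp_linear \<rho>_lin \<rho>_adjoint)

lemma orth_proj_V: "k \<in> SO \<Longrightarrow> orth_proj V (\<rho> k x) = \<rho> k (orth_proj V x)"
  using V_subspace SO_Orth \<rho>_V SO_closed(3) by (intro orth_proj_equivariant) auto

lemmas V_real = complex_subspace_imp_subspace[OF V_subspace]

text \<open>
  The operator \<open>T\<close> followed by the orthogonal projection onto \<open>V\<close> intertwines \<open>\<pi>\<close> with \<open>\<pi>\<^sub>\<phi>\<close>, so it
  is zero on \<open>V\<close>.
\<close>

lemma V_orthogonal_TV:
  assumes "v \<in> V" and "w \<in> V"
  shows "T v \<bullet> w = 0"
proof -
  have "orth_proj V (T v) = 0"
  proof (rule no_reflected_intertwiner[of "\<lambda>x. orth_proj V (T x)"])
    show "complex_linear (\<lambda>x. orth_proj V (T x))"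
      by (rule complex_linear_comp[OF complex_linear_orth_proj[OF V_subspace] \<rho>_lin[OF a_Orth]])
    show "orth_proj V (T x) \<in> V" for x by (rule orth_proj(1)[OF V_real])
    show "orth_proj V (T (\<rho> k x)) = \<rho> (a ** k ** a) (orth_proj V (T x))" if "k \<in> SO" for k x
      using that by (simp add: T_\<rho> orth_proj_V a_SO)
  qed (rule assms)
  then show ?thesis using orth_proj(2)[OF V_real \<open>w \<in> V\<close>, of "T v"] by simp
qed

definition U :: "(complex^'d) set" where
  "U = {v + w |v w. v \<in> V \<and> w \<in> T ` V}"

lemma U_mem: "v \<in> V \<Longrightarrow> w \<in> V \<Longrightarrow> v + T w \<in> U"
  unfolding U_def by blast

lemma V_subset_U: "v \<in> V \<Longrightarrow> v \<in> U"
  using U_mem[of v 0] V_subspace by (simp add: vec.subspace_0 T_linear(3))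

lemma TV_subspace: "vec.subspace (T ` V)"
  using V_subspace unfolding vec.subspace_def
  by (auto simp flip: T_linear(1,2)) (metis T_linear(3) image_eqI)

lemma U_subspace: "vec.subspace U"
  unfolding U_def using vec.subspace_sums[OF V_subspace TV_subspace] by simp

lemma U_cases:
  assumes "u \<in> U"
  obtains v w where "v \<in> V" and "w \<in> V" and "u = v + T w"
  using assms unfolding U_def by blast

lemma \<rho>_TV: "k \<in> SO \<Longrightarrow> v \<in> T ` V \<Longrightarrow> \<rho> k v \<in> T ` V"
  using \<rho>_V a_SO by (auto simp: \<rho>_T)

lemma T_U: "u \<in> U \<Longrightarrow> T u \<in> U"
  by (elim U_cases) (simp add: T_linear U_mem add.commute)

lemma \<rho>_U: "k \<in> Orth \<Longrightarrow> u \<in> U \<Longrightarrow> \<rho> k u \<in> U"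
proof -
  have SO: "\<rho> k u \<in> U" if "k \<in> SO" "u \<in> U" for k u
    using that(2) by (rule U_cases)
      (simp add: that(1) complex_linearD[OF \<rho>_lin[OF SO_Orth]] \<rho>_T U_mem \<rho>_V a_SO)
  assume k: "k \<in> Orth" and u: "u \<in> U"
  show ?thesis
    using k
  proof (cases rule: Orth_cases[where k = k and l = l])
    case 1
    then show ?thesis using SO u by blast
  next
    case (2 k')
    then show ?thesis using SO[of k' "T u"] T_U[OF u] by (simp add: \<rho>_hom SO_Orth a_Orth flip: a_eq)
  qed
qed

text \<open>
  For an invariant subspace \<open>W\<close> with orthogonal projection \<open>?P\<close>, the component of \<open>?P v\<close> in \<open>T ` V\<close>
  depends on \<open>v \<in> V\<close> through an intertwiner of \<open>\<pi>\<close> and \<open>\<pi>\<^sub>\<phi>\<close>, hence is zero, and \<open>?P\<close> maps \<open>V\<close> into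
  \<open>V \<inter> W\<close>. By irreducibility of \<open>V\<close>, either \<open>V \<subseteq> W\<close>, and then also \<open>T ` V \<subseteq> W\<close>, or \<open>W\<close> is
  orthogonal to \<open>V\<close> and, being invariant under \<open>T\<close>, to \<open>T ` V\<close>.
\<close>

lemma irreducible_U: "irreducible_under (\<rho> ` Orth) U"
  unfolding irreducible_under_def
proof (intro conjI allI impI)
  show "vec.subspace U" by (rule U_subspace)
  show "U \<noteq> {0}" using V_nonzero V_subset_U V_subspace vec.subspace_0 by blast
  fix W assume W: "vec.subspace W \<and> W \<subseteq> U \<and> (\<forall>s\<in>\<rho> ` Orth. \<forall>w\<in>W. s w \<in> W)"
  then have sub: "vec.subspace W" and WU: "W \<subseteq> U" and inv: "\<And>k w. k \<in> Orth \<Longrightarrow> w \<in> W \<Longrightarrow> \<rho> k w \<in> W"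
    by auto
  note real = complex_subspace_imp_subspace[OF sub]
  let ?P = "orth_proj W"
  have P: "?P (\<rho> k x) = \<rho> k (?P x)" if "k \<in> Orth" for k x
    using sub that inv Orth_closed(3) by (intro orth_proj_equivariant) auto
  have PV: "?P v \<in> V" if v: "v \<in> V" for v
  proof -
    have 0: "orth_proj V (T (?P v)) = 0"
    proof (rule no_reflected_intertwiner[of "\<lambda>x. orth_proj V (T (?P x))"])
      show "complex_linear (\<lambda>x. orth_proj V (T (?P x)))"
        by (rule complex_linear_comp[OF complex_linear_orth_proj[OF V_subspace]
              complex_linear_comp[OF \<rho>_lin[OF a_Orth] complex_linear_orth_proj[OF sub]]])
      show "orth_proj V (T (?P x)) \<in> V" for x by (rule orth_proj(1)[OF V_real])
      show "orth_proj V (T (?P (\<rho> k x))) = \<rho> (a ** k ** a) (orth_proj V (T (?P x)))" if "k \<in> SO" for k x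
        using that by (simp add: P SO_Orth T_\<rho> orth_proj_V a_SO)
    qed (rule v)
    have "?P v \<in> U" using WU orth_proj(1)[OF real] by blast
    then obtain x y where xy: "x \<in> V" "y \<in> V" "?P v = x + T y" by (rule U_cases)
    then have "orth_proj V (T (?P v)) = y"
      using V_orthogonal_TV by (intro orth_proj_eqI[OF V_real]) (simp_all add: T_linear)
    with 0 xy show ?thesis by (simp add: T_linear(3))
  qed
  have "V \<inter> W = {0} \<or> V \<inter> W = V"
    using irreducible_V
  proof (rule irreducible_underD)
    show "vec.subspace (V \<inter> W)" using V_subspace sub by (rule vec.subspace_inter)
    show "s w \<in> V \<inter> W" if "s \<in> \<rho> ` SO" "w \<in> V \<inter> W" for s w
      using that inv[OF SO_Orth] \<rho>_V by auto
  qed auto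
  then show "W = {0} \<or> W = U"
  proof
    assume "V \<inter> W = V"
    then have "v + T w \<in> W" if "v \<in> V" "w \<in> V" for v w
      using that inv[OF a_Orth] sub vec.subspace_add by blast
    then have "U \<subseteq> W" by (auto elim: U_cases)
    then show ?thesis using WU by blast
  next
    assume "V \<inter> W = {0}"
    then have 0: "?P v = 0" if "v \<in> V" for v
      using PV[OF that] orth_proj(1)[OF real] by blast
    have "u = 0" if "u \<in> W" for u
    proof -
      obtain v w where vw: "v \<in> V" "w \<in> V" "u = v + T w" using WU \<open>u \<in> W\<close> by (blast elim: U_cases)
      have "u = ?P u" using orth_proj_of_member[OF real that] by simp
      also have "\<dots> = ?P v + T (?P w)"
        unfolding vw(3) by (simp add: complex_linearD[OF complex_linear_orth_proj[OF sub]] P a_Orth)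
      finally show ?thesis using 0 vw by (simp add: T_linear(3))
    qed
    then show ?thesis using sub vec.subspace_0 by blast
  qed
qed

section \<open>Multiplicity one\<close>

text \<open>
  The operators commuting with O(n) commute with each other, by Gelfand's trick. So \<open>A\<close> commutes with
  the orthogonal projection onto \<open>U\<close>.
\<close>

lemma Orth_equivariant_preserves_U:
  assumes A: "complex_linear A" and comm: "\<And>k x. k \<in> Orth \<Longrightarrow> A (\<rho> k x) = \<rho> k (A x)" and u: "u \<in> U"
  shows "A u \<in> U"
proof -
  let ?M = "(\<lambda>g. matrix (\<tau> g)) ` SO" and ?H = "(\<lambda>k. matrix (\<rho> k)) ` Orth"
  let ?P = "orth_proj U"
  have P: "complex_linear ?P" by (rule complex_linear_orth_proj[OF U_subspace])
  have PU: "?P (\<rho> k x) = \<rho> k (?P x)" if "k \<in> Orth" for k x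
    by (rule orth_proj_equivariant[OF U_subspace that \<rho>_U[OF that] \<rho>_U[OF Orth_closed(3)[OF that]]])
  have mult: "matrix (\<tau> g) ** matrix (\<tau> h) = matrix (\<tau> (g ** h))" if "g \<in> SO" "h \<in> SO" for g h
    using that by (simp add: matrix_eq matrix_works \<tau>_rep SO_closed flip: matrix_vector_mul_assoc)
  have one: "matrix (\<tau> (mat 1)) = mat 1"
    by (simp add: matrix_eq matrix_works \<tau>_rep SO_closed)
  have inverse: "matrix (\<tau> g) ** matrix (\<tau> (transpose g)) = mat 1" if "g \<in> SO" for g
    using that by (simp add: mult SO_closed) (simp add: SO_def rotation_matrix_def orthogonal_matrix_def one)
  have "matrix A ** matrix ?P = matrix ?P ** matrix A"
  proof (rule gelfand_commuting[of ?M ?H])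
    show "irreducible_under ((*v) ` ?M) UNIV"
    proof -
      have "(*v) (matrix (\<tau> g)) = \<tau> g" if "g \<in> SO" for g
        by (rule ext) (rule matrix_works[OF \<tau>_rep(1)[OF that]])
      then have "(*v) ` ?M = \<tau> ` SO" by (simp add: image_image cong: image_cong)
      then show ?thesis
        using \<tau>_irreducible unfolding irreducible_under_def irreducible_representation_def by simp
    qed
    show "mat 1 \<in> ?M" using one SO_closed(1) by (metis image_eqI)
    show "X ** Y \<in> ?M" if "X \<in> ?M" "Y \<in> ?M" for X Y using that
      by (auto simp: mult intro!: imageI SO_closed(2))
    show "\<exists>Y\<in>?M. X ** Y = mat 1" if "X \<in> ?M" for X using that inverse SO_closed(3) by blast
    show "\<exists>h\<in>?H. \<exists>h'. h ** h' = mat 1 \<and> Y = h ** X ** h'"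
      if X: "X \<in> ?M" and "X ** Y = mat 1" for X Y
    proof -
      obtain g where g: "g \<in> SO" "X = matrix (\<tau> g)" using X by blast
      then have Y: "Y = matrix (\<tau> (transpose g))"
        using \<open>X ** Y = mat 1\<close> inverse[OF g(1)]
        by (metis matrix_inverse_swap matrix_mul_assoc matrix_mul_lid matrix_mul_rid)
      obtain k where k: "k \<in> Orth" "transpose g = embed_SO k ** g ** embed_SO (transpose k)"
        using SO_inverted_by_Orth[OF n_even g(1)] by blast
      have e: "embed_SO k \<in> SO" "embed_SO (transpose k) \<in> SO"
        using k(1) Orth_closed(3) embed_SO_in_SO by blast+
      have "Y = matrix (\<rho> k) ** X ** matrix (\<rho> (transpose k))"
        unfolding Y g(2) k(2) using e g(1) by (simp add: mult SO_closed)
      moreover have "matrix (\<rho> k) ** matrix (\<rho> (transpose k)) = mat 1"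
        using inverse[OF e(1)] by (simp add: embed_SO_transpose)
      ultimately show ?thesis using k(1) by blast
    qed
    show "matrix A ** h = h ** matrix A" if "h \<in> ?H" for h
      using that by (auto simp: matrix_eq matrix_works A \<rho>_lin comm simp flip: matrix_vector_mul_assoc)
    show "matrix ?P ** h = h ** matrix ?P" if "h \<in> ?H" for h
      using that
      by (auto simp: PU matrix_eq matrix_works P \<rho>_lin simp flip: matrix_vector_mul_assoc)
  qed
  then have "(matrix A ** matrix ?P) *v u = (matrix ?P ** matrix A) *v u" by simp
  then have "A (?P u) = ?P (A u)" by (simp add: matrix_works A P flip: matrix_vector_mul_assoc)
  then show ?thesis
    using orth_proj_of_member[OF complex_subspace_imp_subspace[OF U_subspace] u]
      orth_proj(1)[OF complex_subspace_imp_subspace[OF U_subspace]] by metis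
qed

text \<open>
  Conjugating with \<open>T\<close> extends the restriction of \<open>A\<close> to \<open>V\<close> to the O(n)-equivariant operator \<open>?B\<close>
  (an instance of induction from SO(n) to O(n)). Hence \<open>A\<close> maps \<open>V\<close> into \<open>U\<close>, and the component of
  its values in \<open>T ` V\<close> is an intertwiner of \<open>\<pi>\<close> and \<open>\<pi>\<^sub>\<phi>\<close>, hence zero.
\<close>

lemma SO_equivariant_preserves_V:
  assumes A: "complex_linear A" and comm: "\<And>k x. k \<in> SO \<Longrightarrow> A (\<rho> k x) = \<rho> k (A x)" and v: "v \<in> V"
  shows "A v \<in> V"
proof -
  let ?P = "orth_proj V"
  \<comment> \<open>The second summand vanishes on \<open>V\<close>, where \<open>?B\<close> agrees with \<open>A\<close>.\<close>
  let ?B = "\<lambda>x. A (?P x) + T (A (?P (T x)))"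
  have P: "complex_linear ?P" by (rule complex_linear_orth_proj[OF V_subspace])
  have B: "complex_linear ?B"
    by (rule complex_linearI)
      (simp_all add: complex_linearD[OF A] complex_linearD[OF P] T_linear vec.scale_right_distrib)
  have PT: "?P (T x) = 0" if "x \<in> V" for x
    using that V_orthogonal_TV by (intro orth_proj_of_orthogonal[OF V_real])
  have Bv: "?B x = A x" if "x \<in> V" for x
    using that by (simp add: PT orth_proj_of_member[OF V_real] complex_linearD(3)[OF A] T_linear(3))
  have B_SO: "?B (\<rho> k x) = \<rho> k (?B x)" if k: "k \<in> SO" for k x
    using k 
    by (simp add: T_\<rho> orth_proj_V comm a_SO a_conj_twice complex_linearD[OF \<rho>_lin[OF SO_Orth]])
  have B_T: "?B (T x) = T (?B x)" for x by (simp add: T_linear add.commute)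
  have AU: "A x \<in> U" if "x \<in> V" for x
  proof -
    have "?B x \<in> U"
    proof (rule Orth_equivariant_preserves_U[OF B])
      fix k :: "real^'n^'n" and x assume "k \<in> Orth"
      then show "?B (\<rho> k x) = \<rho> k (?B x)"
      proof (cases rule: Orth_cases[where k = k and l = l])
        case 1
        then show ?thesis by (rule B_SO)
      next
        case (2 k')
        then have "\<rho> k y = \<rho> k' (T y)" for y by (simp add: \<rho>_hom SO_Orth a_Orth flip: a_eq)
        then show ?thesis using B_SO[OF 2(1), of "T x"] B_T by simp
      qed
    qed (rule V_subset_U[OF that])
    then show ?thesis by (simp only: Bv[OF that])
  qed
  obtain x y where xy: "x \<in> V" "y \<in> V" "A v = x + T y" using AU[OF v] by (rule U_cases)
  have "?P (T (A v)) = 0"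
  proof (rule no_reflected_intertwiner[of "\<lambda>x. ?P (T (A x))"])
    show "complex_linear (\<lambda>x. ?P (T (A x)))"
      by (rule complex_linear_comp[OF P complex_linear_comp[OF \<rho>_lin[OF a_Orth] A]])
    show "?P (T (A x)) \<in> V" for x by (rule orth_proj(1)[OF V_real])
    show "?P (T (A (\<rho> k x))) = \<rho> (a ** k ** a) (?P (T (A x)))" if "k \<in> SO" for k x
      using that by (simp add: comm T_\<rho> orth_proj_V a_SO)
  qed (rule v)
  moreover have "?P (T (A v)) = y"
    using xy PT orth_proj_of_member[OF V_real] by (simp add: T_linear complex_linearD[OF P])
  ultimately show ?thesis using xy by (simp add: T_linear(3))
qed

lemma SO_equivariant_preserves_TV:
  assumes A: "complex_linear A" and comm: "\<And>k x. k \<in> SO \<Longrightarrow> A (\<rho> k x) = \<rho> k (A x)"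
    and v: "v \<in> T ` V"
  shows "A v \<in> T ` V"
proof -
  obtain w where w: "w \<in> V" "v = T w" using v by blast
  have "T (A (T w)) \<in> V"
  proof (rule SO_equivariant_preserves_V[of "\<lambda>x. T (A (T x))"])
    show "complex_linear (\<lambda>x. T (A (T x)))" 
      by (rule complex_linear_comp[OF \<rho>_lin[OF a_Orth] complex_linear_comp[OF A \<rho>_lin[OF a_Orth]]])
    show "T (A (T (\<rho> k x))) = \<rho> k (T (A (T x)))" if "k \<in> SO" for k x
      using that by (simp add: T_\<rho> comm a_SO a_conj_twice)
  qed (rule w)
  then show ?thesis using w by (metis T_T image_eqI)
qed

lemma irreducible_TV: "irreducible_under (\<rho> ` SO) (T ` V)"
  unfolding irreducible_under_def
proof (intro conjI allI impI)
  show "vec.subspace (T ` V)" by (rule TV_subspace)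
  show "T ` V \<noteq> {0}"
  proof
    assume "T ` V = {0}"
    then have "T v = 0" if "v \<in> V" for v using that by blast
    then have "v = 0" if "v \<in> V" for v using that T_T[of v] by (simp add: T_linear(3))
    then show False using V_nonzero vec.subspace_0[OF V_subspace] by blast
  qed
  fix W assume W: "vec.subspace W \<and> W \<subseteq> T ` V \<and> (\<forall>s\<in>\<rho> ` SO. \<forall>w\<in>W. s w \<in> W)"
  have TTW: "T ` (T ` X) = X" for X by (simp add: image_image)
  have "T ` W = {0} \<or> T ` W = V"
  proof (rule irreducible_underD[OF irreducible_V])
    show "vec.subspace (T ` W)"
      using W unfolding vec.subspace_def
      by (auto simp flip: T_linear(1,2)) (metis T_linear(3) image_eqI)
    show "T ` W \<subseteq> V" using W TTW by (metis image_mono)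
    show "s w \<in> T ` W" if "s \<in> \<rho> ` SO" "w \<in> T ` W" for s w
      using that W a_SO by (auto simp: \<rho>_T)
  qed
  then show "W = {0} \<or> W = T ` V"
    using TTW by (metis T_linear(3) image_empty image_insert)
qed

section \<open>Block form of the spherical functions\<close>

lemma group_representation:
  assumes "K \<subseteq> Orth" and "compact K" and "normalized_haar K \<mu>"
    and "mat 1 \<in> K" and "\<And>k l. k \<in> K \<Longrightarrow> l \<in> K \<Longrightarrow> k ** l \<in> K" and "\<And>k. k \<in> K \<Longrightarrow> transpose k \<in> K"
  shows "compact_group_representation K \<mu> \<rho>"
proof (rule compact_group_representation.intro[OF assms(3,2,4,5,6)])
  fix k assume "k \<in> K"
  then have k: "k \<in> Orth" using assms(1) by blast
  then show "orthogonal_matrix k" by (simp add: Orth_def)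
  show "complex_linear (\<rho> k)" by (rule \<rho>_lin[OF k])
  show "\<rho> k x \<bullet> \<rho> k y = x \<bullet> y" for x y by (rule \<rho>_isometry[OF k])
  show "\<rho> (k ** k') x = \<rho> k (\<rho> k' x)" if "k' \<in> K" for k' x
    using that assms(1) by (intro \<rho>_hom k) blast
qed (auto simp: \<rho>_one intro: continuous_on_subset[OF \<rho>_continuous assms(1)])

text \<open>
  A type \<open>\<delta>\<close> that is realised on an irreducible subspace \<open>W\<close> with multiplicity one. The hypothesis
  \<open>mult_one\<close> expresses this: no equivariant operator moves \<open>W\<close> to another copy of itself.
\<close>

lemma isotypic_projection_eq_orth_proj:
  fixes \<delta> :: "real^'n^'n \<Rightarrow> 'v::euclidean_space \<Rightarrow> 'v"
  assumes K: "compact_group_representation K \<mu> \<rho>"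
    and irr: "irreducible_under (\<rho> ` K) W"
    and inv: "\<And>k u. k \<in> K \<Longrightarrow> u \<in> W \<Longrightarrow> \<rho> k u \<in> W"
    and mult_one: "\<forall>A. complex_linear A \<longrightarrow> (\<forall>k\<in>K. \<forall>x. A (\<rho> k x) = \<rho> k (A x)) \<longrightarrow> (\<forall>u\<in>W. A u \<in> W)"
    and s: "vector_space s" and X: "module.subspace s X" and bij: "bij_betw f X W"
    and add: "\<And>v w. v \<in> X \<Longrightarrow> w \<in> X \<Longrightarrow> f (v + w) = f v + f w"
    and scale: "\<And>c v. v \<in> X \<Longrightarrow> f (s c v) = c *s f v"
    and \<delta>: "\<And>k v. k \<in> K \<Longrightarrow> v \<in> X \<Longrightarrow> \<delta> k v \<in> X"
      "\<And>k v. k \<in> K \<Longrightarrow> v \<in> X \<Longrightarrow> f (\<delta> k v) = \<rho> k (f v)"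
  shows "isotypic_projection \<mu> s X \<delta> \<tau> = orth_proj W" and "isotypic_subspace \<mu> s X \<delta> \<tau> = W"
    and "u \<in> W \<Longrightarrow> spherical_function \<mu> s X \<delta> \<tau> g u = orth_proj W (\<tau> g u)"
proof -
  interpret compact_group_representation K \<mu> \<rho> by (rule K)
  obtain C where C: "vec.independent C" "vec.span C = W" "\<And>k. k \<in> K \<Longrightarrow>
      chi s X \<delta> k = of_nat (card C) * (\<Sum>c\<in>C. vec.representation C (\<rho> k c) c)"
    by (rule chi_transport[where \<rho> = \<rho> and K = K and f = f, OF s X bij add scale \<delta>]) (assumption | rule that)+
  show proj: "isotypic_projection \<mu> s X \<delta> \<tau> = orth_proj W"
    unfolding isotypic_projection_def
  proof (rule ext)
    fix w
    show "(LINT k|\<mu>. chi s X \<delta> (matrix_inv k) *s \<rho> k w) = orth_proj W w"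
    proof (rule character_projection[OF irr _ _ C(1,2)])
      show "\<rho> k u \<in> W" if "k \<in> K" "u \<in> W" for k u using that by (rule inv)
      show "A u \<in> W"
        if "complex_linear A" "\<And>k x. k \<in> K \<Longrightarrow> A (\<rho> k x) = \<rho> k (A x)" "u \<in> W" for A u
        using mult_one that by blast
      show "chi s X \<delta> k = of_nat (card C) * (\<Sum>c\<in>C. vec.representation C (\<rho> k c) c)" if "k \<in> K" for k
        using that by (rule C(3))
    qed
  qed
  have W: "subspace W" using irr by (simp add: irreducible_under_def complex_subspace_imp_subspace)
  show sub: "isotypic_subspace \<mu> s X \<delta> \<tau> = W"
    unfolding isotypic_subspace_def proj
    using orth_proj(1)[OF W] orth_proj_of_member[OF W] by (metis image_subsetI rangeI subsetI subset_antisym)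
  show "spherical_function \<mu> s X \<delta> \<tau> g u = orth_proj W (\<tau> g u)" if "u \<in> W"
    using that by (simp add: spherical_function_def sub proj)
qed

text \<open>
  The two summands of \<open>U\<close> are orthogonal.
\<close>

lemma orth_proj_U: "orth_proj U x = orth_proj V x + orth_proj (T ` V) x"
proof (rule orth_proj_eqI)
  note TVr = complex_subspace_imp_subspace[OF TV_subspace]
  note p = orth_proj(1)[OF V_real, of x] orth_proj(1)[OF TVr, of x]
  show "subspace U" by (rule complex_subspace_imp_subspace[OF U_subspace])
  show "orth_proj V x + orth_proj (T ` V) x \<in> U" using p unfolding U_def by blast
  fix u assume "u \<in> U"
  then obtain v w where vw: "v \<in> V" "w \<in> V" "u = v + T w" by (rule U_cases)
  have "(x - orth_proj V x) \<bullet> v = 0" "(x - orth_proj (T ` V) x) \<bullet> T w = 0"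
    using orth_proj(2)[OF V_real] orth_proj(2)[OF TVr] vw by blast+
  moreover have "orth_proj V x \<bullet> T w = 0" "orth_proj (T ` V) x \<bullet> v = 0"
    using p V_orthogonal_TV vw by (auto simp: inner_commute)
  ultimately show "(x - (orth_proj V x + orth_proj (T ` V) x)) \<bullet> u = 0"
    unfolding vw(3) by (simp add: inner_diff_left inner_add_left inner_add_right)
qed

lemma group_representation_SO:
  "normalized_haar SO \<mu> \<Longrightarrow> compact_group_representation SO \<mu> \<rho>"
  by (intro group_representation SO_subset_Orth compact_SO SO_closed)

lemma group_representation_Orth:
  "normalized_haar Orth \<nu> \<Longrightarrow> compact_group_representation Orth \<nu> \<rho>"
  by (intro group_representation order_refl compact_Orth Orth_closed)

lemma T_bij: "bij_betw T V (T ` V)"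
  unfolding bij_betw_def by (metis T_T inj_on_def)

lemma inv_into_T: "x \<in> T ` V \<Longrightarrow> inv_into V T x = T x"
  using T_bij by (auto simp: bij_betw_def)

lemma \<pi>\<^sub>\<phi>_V: "k \<in> SO \<Longrightarrow> v \<in> V \<Longrightarrow> \<pi>\<^sub>\<phi> k v \<in> V"
  by (simp add: \<pi>\<^sub>\<phi>_rho \<rho>_V a_SO)

lemma T_\<pi>\<^sub>\<phi>: "k \<in> SO \<Longrightarrow> v \<in> V \<Longrightarrow> T (\<pi>\<^sub>\<phi> k v) = \<rho> k (T v)"
  by (simp add: \<pi>\<^sub>\<phi>_rho \<rho>_T)

lemma restrict_to_subspace:
  assumes "K \<subseteq> Orth" and "vec.subspace W" and "\<And>k w. k \<in> K \<Longrightarrow> w \<in> W \<Longrightarrow> \<rho> k w \<in> W"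
  shows "matrix_group_rep K (*s) W \<rho>"
  unfolding matrix_group_rep_def
  using assms continuous_on_subset[OF \<rho>_continuous assms(1)]
  by (auto simp: complex_linearD[OF \<rho>_lin] \<rho>_hom \<rho>_one subset_iff)

lemma TV_equivalent:
  "equivalent_representations SO (*s) (T ` V) \<rho> (*s) V \<pi>\<^sub>\<phi>"
  unfolding equivalent_representations_def
proof (intro exI[of _ T] conjI ballI allI)
  show "bij_betw T (T ` V) V"
    unfolding bij_betw_def by (auto simp: image_image intro!: inj_onI)
  show "T (\<rho> k v) = \<pi>\<^sub>\<phi> k (T v)" if "k \<in> SO" "v \<in> T ` V" for k v
    using that by (auto simp: T_\<pi>\<^sub>\<phi>[symmetric])
qed (simp_all add: T_linear)

lemma V_Int_TV: "V \<inter> T ` V = {0}"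
proof -
  have "x = 0" if "x \<in> V" "x \<in> T ` V" for x
  proof -
    obtain w where "w \<in> V" "x = T w" using \<open>x \<in> T ` V\<close> by (rule imageE)
    then have "x \<bullet> x = 0" using V_orthogonal_TV[OF _ \<open>x \<in> V\<close>] by simp
    then show ?thesis by simp
  qed
  then show ?thesis
    using V_subspace TV_subspace by (auto simp: vec.subspace_0)
qed

lemma irreducible_representation_U: "irreducible_representation Orth (*s) U \<rho>"
  using restrict_to_subspace[OF order_refl U_subspace \<rho>_U] irreducible_U
  unfolding irreducible_representation_def irreducible_under_def by blast

definition \<iota> :: "(complex^'d) \<times> (complex^'d) \<Rightarrow> complex^'d" where
  "\<iota> = (\<lambda>(v, w). v + T w)"

sublocale pair: vector_space_prod "(*s) :: complex \<Rightarrow> complex^'d \<Rightarrow> _" "(*s) :: complex \<Rightarrow> complex^'d \<Rightarrow> _"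
  by unfold_locales

lemma \<iota>_linear: "Vector_Spaces.linear scale_pair (*s) \<iota>"
  unfolding Vector_Spaces.linear_iff
  using pair.p.vector_space_axioms vec.vector_space_axioms
  by (auto simp: \<iota>_def pair.scale_def T_linear vec.scale_right_distrib)

lemma \<iota>_bij: "bij_betw \<iota> (V \<times> V) U"
  unfolding bij_betw_def
proof
  show "inj_on \<iota> (V \<times> V)"
  proof (rule inj_onI, clarify)
    fix v w v' w' assume m: "v \<in> V" "w \<in> V" "v' \<in> V" "w' \<in> V" and "\<iota> (v, w) = \<iota> (v', w')"
    then have eq: "v - v' = T (w' - w)" by (simp add: \<iota>_def T_linear algebra_simps)
    have "v - v' \<in> V" "w' - w \<in> V" using m V_subspace by (simp_all add: vec.subspace_diff)
    then have "v - v' \<in> V \<inter> T ` V" using eq by (intro IntI) (simp_all only: imageI)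
    then have "v - v' = 0" using V_Int_TV by blast
    moreover from this have "T (T (w' - w)) = T 0" using eq by simp
    then have "w' - w = 0" by (simp only: T_T T_linear(3))
    ultimately show "v = v' \<and> w = w'" by simp
  qed
  show "\<iota> ` (V \<times> V) = U" by (auto simp: \<iota>_def U_def image_iff)
qed

lemma V_V_subspace: "module.subspace scale_pair (V \<times> V)"
  using pair.subspace_Times[OF V_subspace V_subspace] .

end

theorem theorem3p3:
  fixes \<tau> :: "real^('n::finite option)^('n option) \<Rightarrow> complex^('d::finite) \<Rightarrow> complex^'d"
    and V\<^sub>\<pi> :: "(complex^'d) set"
    and \<pi> \<pi>\<^sub>\<phi> :: "real^'n^'n \<Rightarrow> complex^'d \<Rightarrow> complex^'d"
    and \<gamma> :: "real^'n^'n \<Rightarrow> (complex^'d) \<times> (complex^'d) \<Rightarrow> (complex^'d) \<times> (complex^'d)"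
    and l :: 'n
    and a :: "real^'n^'n"
  assumes n_even: "even CARD('n)"
    and a_eq: "a = reflection l"
    and \<tau>_irreducible: "irreducible_representation SO (*s) UNIV \<tau>"
    and \<tau>_unitary: "unitary_on SO UNIV \<tau>"
    and \<pi>_irreducible: "irreducible_representation SO (*s) V\<^sub>\<pi> \<pi>"
    and \<pi>_unitary: "unitary_on SO V\<^sub>\<pi> \<pi>"
    and \<pi>_subrepresentation: "\<forall>k\<in>SO. \<forall>v\<in>V\<^sub>\<pi>. \<pi> k v = \<tau> (embed_SO k) v"
    and \<pi>\<^sub>\<phi>_eq: "\<pi>\<^sub>\<phi> = (\<lambda>k. \<pi> (a ** k ** a))"
    and \<pi>_not_equivalent: "\<not> equivalent_representations SO (*s) V\<^sub>\<pi> \<pi> (*s) V\<^sub>\<pi> \<pi>\<^sub>\<phi>"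
    and \<gamma>_rotation:
      "\<forall>k\<in>SO. \<forall>v\<in>V\<^sub>\<pi>. \<forall>w\<in>V\<^sub>\<pi>. \<gamma> k (v, w) = (\<pi> k v, \<pi>\<^sub>\<phi> k w)"
    and \<gamma>_reflection:
      "\<forall>k\<in>SO. \<forall>v\<in>V\<^sub>\<pi>. \<forall>w\<in>V\<^sub>\<pi>. \<gamma> (k ** a) (v, w) = (\<pi> k w, \<pi>\<^sub>\<phi> k v)"
  shows
    "matrix_group_rep SO (*s) (\<tau> (embed_SO a) ` V\<^sub>\<pi>) (\<lambda>k. \<tau> (embed_SO k)) \<and>
     equivalent_representations SO
       (*s) (\<tau> (embed_SO a) ` V\<^sub>\<pi>) (\<lambda>k. \<tau> (embed_SO k))
       (*s) V\<^sub>\<pi> \<pi>\<^sub>\<phi> \<and>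
     V\<^sub>\<pi> \<inter> \<tau> (embed_SO a) ` V\<^sub>\<pi> = {0} \<and>
     irreducible_representation Orth
       (*s) {v + w | v w. v \<in> V\<^sub>\<pi> \<and> w \<in> \<tau> (embed_SO a) ` V\<^sub>\<pi>} (\<lambda>k. \<tau> (embed_SO k)) \<and>
     irreducible_representation Orth scale_pair (V\<^sub>\<pi> \<times> V\<^sub>\<pi>) \<gamma> \<and>
     equivalent_representations Orth
       (*s) {v + w | v w. v \<in> V\<^sub>\<pi> \<and> w \<in> \<tau> (embed_SO a) ` V\<^sub>\<pi>} (\<lambda>k. \<tau> (embed_SO k))
       scale_pair (V\<^sub>\<pi> \<times> V\<^sub>\<pi>) \<gamma> \<and>
     (\<forall>\<mu> \<nu>. normalized_haar SO \<mu> \<and> normalized_haar Orth \<nu> \<longrightarrow>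
       (let \<Phi>\<^sub>\<pi> = spherical_function \<mu> (*s) V\<^sub>\<pi> \<pi> \<tau>;
            \<Phi>\<^sub>\<phi> = (\<lambda>g. transport (\<tau> (embed_SO a)) V\<^sub>\<pi> (spherical_function \<mu> (*s) V\<^sub>\<pi> \<pi>\<^sub>\<phi> \<tau> g));
            \<Phi>\<^sub>\<gamma> = spherical_function \<nu> scale_pair (V\<^sub>\<pi> \<times> V\<^sub>\<pi>) \<gamma> \<tau>;
            \<iota> = (\<lambda>(v, w). v + \<tau> (embed_SO a) w)
        in isotypic_subspace \<mu> (*s) V\<^sub>\<pi> \<pi> \<tau> = V\<^sub>\<pi> \<and>
           bij_betw (\<tau> (embed_SO a)) V\<^sub>\<pi> (isotypic_subspace \<mu> (*s) V\<^sub>\<pi> \<pi>\<^sub>\<phi> \<tau>) \<and>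
           bij_betw \<iota> (V\<^sub>\<pi> \<times> V\<^sub>\<pi>) (isotypic_subspace \<nu> scale_pair (V\<^sub>\<pi> \<times> V\<^sub>\<pi>) \<gamma> \<tau>) \<and>
           (\<forall>g\<in>SO. \<forall>x \<in> V\<^sub>\<pi> \<times> V\<^sub>\<pi>.
              transport \<iota> (V\<^sub>\<pi> \<times> V\<^sub>\<pi>) (\<Phi>\<^sub>\<gamma> g) x =
              block_matrix (\<Phi>\<^sub>\<pi> g) (\<Phi>\<^sub>\<pi> (g ** embed_SO a))
                           (\<Phi>\<^sub>\<phi> (g ** embed_SO a)) (\<Phi>\<^sub>\<phi> g) x)))"
proof -
  interpret reflected_subrepresentation \<tau> V\<^sub>\<pi> \<pi> \<pi>\<^sub>\<phi> l a
    by unfold_locales (fact n_even a_eq \<tau>_irreducible \<tau>_unitary \<pi>_irreducible \<pi>_subrepresentation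
        \<pi>\<^sub>\<phi>_eq \<pi>_not_equivalent)+
  let ?VV = "V\<^sub>\<pi> \<times> V\<^sub>\<pi>"
  have \<gamma>: "\<gamma> k x \<in> ?VV \<and> \<iota> (\<gamma> k x) = \<rho> k (\<iota> x)" if "k \<in> Orth" and "x \<in> ?VV" for k x
  proof -
    obtain v w where x: "x = (v, w)" and v: "v \<in> V\<^sub>\<pi>" and w: "w \<in> V\<^sub>\<pi>"
      using \<open>x \<in> ?VV\<close> by (rule SigmaE)
    show ?thesis
      using \<open>k \<in> Orth\<close>
    proof (cases rule: Orth_cases[where k = k and l = l])
      case 1
      then show ?thesis
        unfolding x using v w
        by (simp add: \<gamma>_rotation \<iota>_def T_\<pi>\<^sub>\<phi> \<pi>\<^sub>\<phi>_V \<pi>_eq \<rho>_V complex_linearD[OF \<rho>_lin[OF SO_Orth]])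
    next
      case (2 k')
      then show ?thesis
        unfolding x a_eq[symmetric] using v w
        by (simp add: \<gamma>_reflection \<iota>_def T_\<pi>\<^sub>\<phi> \<pi>\<^sub>\<phi>_V \<pi>_eq \<rho>_V \<rho>_hom SO_Orth a_Orth T_linear
            complex_linearD[OF \<rho>_lin[OF SO_Orth]] add.commute)
    qed
  qed
  have scale_real: "scale_pair (of_real r) x = r *\<^sub>R x" for r and x :: "(complex^'d) \<times> (complex^'d)"
    by (simp add: pair.scale_def scaleR_eq_complex_scale prod_eq_iff)
  note transport_\<gamma> = irreducible_representation_transport[OF irreducible_representation_U scale_real
      \<iota>_linear V_V_subspace \<iota>_bij, of \<gamma>, OF conjunct1[OF \<gamma>] conjunct2[OF \<gamma>] Orth_closed(1,2)]
  have part1: "matrix_group_rep SO (*s) (T ` V\<^sub>\<pi>) \<rho>"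
    by (rule restrict_to_subspace[OF SO_subset_Orth TV_subspace \<rho>_TV])
  have part2: "isotypic_subspace \<mu> (*s) V\<^sub>\<pi> \<pi> \<tau> = V\<^sub>\<pi> \<and>
      bij_betw T V\<^sub>\<pi> (isotypic_subspace \<mu> (*s) V\<^sub>\<pi> \<pi>\<^sub>\<phi> \<tau>) \<and>
      bij_betw \<iota> ?VV (isotypic_subspace \<nu> scale_pair ?VV \<gamma> \<tau>) \<and>
      (\<forall>g\<in>SO. \<forall>x\<in>?VV.
        transport \<iota> ?VV (spherical_function \<nu> scale_pair ?VV \<gamma> \<tau> g) x =
        block_matrix (spherical_function \<mu> (*s) V\<^sub>\<pi> \<pi> \<tau> g)
          (spherical_function \<mu> (*s) V\<^sub>\<pi> \<pi> \<tau> (g ** embed_SO a))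
          (transport T V\<^sub>\<pi> (spherical_function \<mu> (*s) V\<^sub>\<pi> \<pi>\<^sub>\<phi> \<tau> (g ** embed_SO a)))
          (transport T V\<^sub>\<pi> (spherical_function \<mu> (*s) V\<^sub>\<pi> \<pi>\<^sub>\<phi> \<tau> g)) x)"
    if "normalized_haar SO \<mu>" and "normalized_haar Orth \<nu>" for \<mu> \<nu>
  proof -
    have mult_V: "\<forall>A. complex_linear A \<longrightarrow> (\<forall>k\<in>SO. \<forall>x. A (\<rho> k x) = \<rho> k (A x)) \<longrightarrow> (\<forall>u\<in>V\<^sub>\<pi>. A u \<in> V\<^sub>\<pi>)"
      using SO_equivariant_preserves_V by blast
    have mult_TV: "\<forall>A. complex_linear A \<longrightarrow> (\<forall>k\<in>SO. \<forall>x. A (\<rho> k x) = \<rho> k (A x)) \<longrightarrow>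
        (\<forall>u\<in>T ` V\<^sub>\<pi>. A u \<in> T ` V\<^sub>\<pi>)"
      using SO_equivariant_preserves_TV by blast
    have mult_U: "\<forall>A. complex_linear A \<longrightarrow> (\<forall>k\<in>Orth. \<forall>x. A (\<rho> k x) = \<rho> k (A x)) \<longrightarrow> (\<forall>u\<in>U. A u \<in> U)"
      using Orth_equivariant_preserves_U by blast
    interpret \<iota>: Vector_Spaces.linear scale_pair "(*s)" \<iota> by (rule \<iota>_linear)
    have bij_id: "bij_betw (\<lambda>v. v) V\<^sub>\<pi> V\<^sub>\<pi>" by (simp add: bij_betw_def)
    note p = isotypic_projection_eq_orth_proj[OF group_representation_SO[OF that(1)] irreducible_V \<rho>_V
        mult_V vec.vector_space_axioms V_subspace bij_id, where \<delta> = \<pi>]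
    have pi: "isotypic_subspace \<mu> (*s) V\<^sub>\<pi> \<pi> \<tau> = V\<^sub>\<pi>"
      "\<And>u g. u \<in> V\<^sub>\<pi> \<Longrightarrow> spherical_function \<mu> (*s) V\<^sub>\<pi> \<pi> \<tau> g u = orth_proj V\<^sub>\<pi> (\<tau> g u)"
      by (rule p(2); simp add: \<pi>_eq \<rho>_V) (rule p(3); simp add: \<pi>_eq \<rho>_V)
    note q = isotypic_projection_eq_orth_proj[OF group_representation_SO[OF that(1)] irreducible_TV \<rho>_TV
        mult_TV vec.vector_space_axioms V_subspace T_bij, where \<delta> = \<pi>\<^sub>\<phi>]
    have phi: "isotypic_subspace \<mu> (*s) V\<^sub>\<pi> \<pi>\<^sub>\<phi> \<tau> = T ` V\<^sub>\<pi>"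
      "\<And>u g. u \<in> T ` V\<^sub>\<pi> \<Longrightarrow>
        spherical_function \<mu> (*s) V\<^sub>\<pi> \<pi>\<^sub>\<phi> \<tau> g u = orth_proj (T ` V\<^sub>\<pi>) (\<tau> g u)"
      by (rule q(2); simp add: T_linear \<pi>\<^sub>\<phi>_V T_\<pi>\<^sub>\<phi>) (rule q(3); simp add: T_linear \<pi>\<^sub>\<phi>_V T_\<pi>\<^sub>\<phi>)
    note r = isotypic_projection_eq_orth_proj[OF group_representation_Orth[OF that(2)] irreducible_U \<rho>_U
        mult_U pair.p.vector_space_axioms V_V_subspace \<iota>_bij, where \<delta> = \<gamma>]
    have gamma: "isotypic_subspace \<nu> scale_pair ?VV \<gamma> \<tau> = U"
      "\<And>u g. u \<in> U \<Longrightarrow> spherical_function \<nu> scale_pair ?VV \<gamma> \<tau> g u = orth_proj U (\<tau> g u)"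
      by (rule r(2); simp add: \<iota>.add \<iota>.scale \<gamma>) (rule r(3); simp add: \<iota>.add \<iota>.scale \<gamma>)
    have "transport \<iota> ?VV (spherical_function \<nu> scale_pair ?VV \<gamma> \<tau> g) x =
        block_matrix (spherical_function \<mu> (*s) V\<^sub>\<pi> \<pi> \<tau> g)
          (spherical_function \<mu> (*s) V\<^sub>\<pi> \<pi> \<tau> (g ** embed_SO a))
          (transport T V\<^sub>\<pi> (spherical_function \<mu> (*s) V\<^sub>\<pi> \<pi>\<^sub>\<phi> \<tau> (g ** embed_SO a)))
          (transport T V\<^sub>\<pi> (spherical_function \<mu> (*s) V\<^sub>\<pi> \<pi>\<^sub>\<phi> \<tau> g)) x"
      if g: "g \<in> SO" and x: "x \<in> ?VV" for g x
    proof -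
      obtain v w where vw: "x = (v, w)" "v \<in> V\<^sub>\<pi>" "w \<in> V\<^sub>\<pi>" using x by blast
      let ?y = "\<tau> g (v + T w)"
      have y: "?y = \<tau> g v + \<tau> g (T w)" by (simp add: complex_linearD[OF \<tau>_rep(1)[OF g]])
      have ga: "\<tau> (g ** embed_SO a) u = \<tau> g (T u)" for u
        by (rule \<tau>_rep(2)[OF g embed_SO_in_SO[OF a_Orth]])
      let ?P = "orth_proj V\<^sub>\<pi>" and ?Q = "orth_proj (T ` V\<^sub>\<pi>)"
      have P: "complex_linear ?P" "complex_linear ?Q"
        using complex_linear_orth_proj V_subspace TV_subspace by blast+
      have mem: "?P z \<in> V\<^sub>\<pi>" "?Q z \<in> T ` V\<^sub>\<pi>" for z
        using orth_proj(1) V_subspace TV_subspace complex_subspace_imp_subspace by blast+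
      have TQ: "T (?Q z) \<in> V\<^sub>\<pi>" for z using mem(2)[of z] by force
      \<comment> \<open>Both columns of the block matrix project a summand of \<open>?y\<close>: the arguments \<open>g ** embed_SO a\<close> and
         the transport along \<open>T\<close> each contribute one factor \<open>T\<close>, and \<open>T\<close> is an involution.\<close>
      have "block_matrix (spherical_function \<mu> (*s) V\<^sub>\<pi> \<pi> \<tau> g)
          (spherical_function \<mu> (*s) V\<^sub>\<pi> \<pi> \<tau> (g ** embed_SO a))
          (transport T V\<^sub>\<pi> (spherical_function \<mu> (*s) V\<^sub>\<pi> \<pi>\<^sub>\<phi> \<tau> (g ** embed_SO a)))
          (transport T V\<^sub>\<pi> (spherical_function \<mu> (*s) V\<^sub>\<pi> \<pi>\<^sub>\<phi> \<tau> g)) x = (?P ?y, T (?Q ?y))"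
        unfolding y using vw mem
        by (simp add: block_matrix_def transport_def pi phi inv_into_T ga T_linear
            complex_linearD[OF P(1)] complex_linearD[OF P(2)])
      moreover have "\<iota> (?P ?y, T (?Q ?y)) = orth_proj U ?y"
        by (simp add: \<iota>_def orth_proj_U)
      then have "inv_into ?VV \<iota> (orth_proj U ?y) = (?P ?y, T (?Q ?y))"
        using inv_into_f_f[OF bij_betw_imp_inj_on[OF \<iota>_bij], of "(?P ?y, T (?Q ?y))"]
        by (simp only: mem_Sigma_iff mem(1) TQ)
      moreover have "transport \<iota> ?VV (spherical_function \<nu> scale_pair ?VV \<gamma> \<tau> g) x =
          inv_into ?VV \<iota> (orth_proj U ?y)"
        using x vw by (simp add: transport_def gamma U_mem \<iota>_def)
      ultimately show ?thesis by simp
    qed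
    then show ?thesis using pi(1) phi(1) gamma(1) T_bij \<iota>_bij by simp
  qed
  show ?thesis
    unfolding Let_def U_def[symmetric] \<iota>_def[symmetric]
    using part1 TV_equivalent V_Int_TV irreducible_representation_U transport_\<gamma> part2 by blast
qed

end
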